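(* Let $p\in(1,\infty)$, let $\varphi$ be an admissible function for $p$ (as defined in the context), and write $d=d_{p,\varphi}$ and $d^g=(d_{p,\varphi})^g$. Suppose that the function $x\mapsto\varphi'(|x|)$ belongs to $L^p(\mathbb R^N)$. Then for every $A\in\mathcal I$ and every $\rho>0$ the set $$\mathbb D^g(A,\rho)=\{B\in\mathcal I : d^g(A,B)\le\rho\}$$ is compact in the topology of $(\mathcal I,d)$. Consequently: (i) any two $A,B\in\mathcal I$ can be connected by a minimal geodesic; (ii) for any finite collection $A_1,\dots,A_n\in\mathcal I$ the Geodesic Distance Based Averaging exists, i.e. the function $A\mapsto\sum_{j=1}^n d^g(A,A_j)^2$ attains its minimum on $\mathcal I$.
   Context: $\mathcal I$ denotes the family of all nonempty compact subsets of $\mathbb R^N$. For $A\in\mathcal I$, $u_A(x)=\inf_{y\in A}|x-y|$. Given $p\in(1,\infty)$, a function $\varphi:[0,\infty)\to(0,\infty)$ is admissible for $p$ if it is strictly decreasing, of class $C^1$, and $x\mapsto\varphi(|x|)$ belongs to $L^p(\mathbb R^N)$. For $A,B\in\mathcal I$, $d_{p,\varphi}(A,B)=\|\varphi\circ u_A-\varphi\circ u_B\|_{L^p(\mathbb R^N)}$ (this is a metric on $\mathcal I$). For a metric space $(M,d)$, the length of a continuous curve $\gamma:[\alpha,\beta]\to M$ is $\operatorname{len}^d\gamma=\sup_T\sum_{i=1}^n d(\gamma(t_{i-1}),\gamma(t_i))$, over all finite subsets $T=\{t_0\le\dots\le t_n\}$ of $[\alpha,\beta]$. The induced geodesic distance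 is $d^g(x,y)=\inf_\gamma\operatorname{len}^d\gamma\in[0,\infty]$, over all $d$-continuous curves $\gamma$ connecting $x$ to $y$. A minimal geodesic connecting $x$ and $y$ is a $d$-continuous curve connecting them with $\operatorname{len}^d\gamma=d^g(x,y)$. *)

theory Defs
  imports "HOL-Analysis.Analysis"
begin

section \<open>Length structures in metric spaces\<close>

definition curve_in :: "'m set \<Rightarrow> ('m \<Rightarrow> 'm \<Rightarrow> real) \<Rightarrow> real \<Rightarrow> real \<Rightarrow> (real \<Rightarrow> 'm) \<Rightarrow> bool" where
  "curve_in M d \<alpha> \<beta> \<gamma> \<longleftrightarrow>
     \<alpha> \<le> \<beta> \<and> continuous_map (top_of_set {\<alpha>..\<beta>}) (Metric_space.mtopology M d) \<gamma>"

definition connects :: "real \<Rightarrow> real \<Rightarrow> (real \<Rightarrow> 'm) \<Rightarrow> 'm \<Rightarrow> 'm \<Rightarrow> bool" where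
  "connects \<alpha> \<beta> \<gamma> x y \<longleftrightarrow> \<gamma> \<alpha> = x \<and> \<gamma> \<beta> = y"

text \<open>A finite subset of \<open>[\<alpha>, \<beta>]\<close> is given by \<open>n\<close> and a function \<open>t\<close>, of which only the values
  \<open>t 0 \<le> \<dots> \<le> t n\<close> matter.\<close>

definition subdivisions :: "real \<Rightarrow> real \<Rightarrow> (nat \<times> (nat \<Rightarrow> real)) set" where
  "subdivisions \<alpha> \<beta> = {(n, t). mono_on {0..n} t \<and> t ` {0..n} \<subseteq> {\<alpha>..\<beta>}}"

definition curve_len :: "('m \<Rightarrow> 'm \<Rightarrow> real) \<Rightarrow> real \<Rightarrow> real \<Rightarrow> (real \<Rightarrow> 'm) \<Rightarrow> ennreal" where
  "curve_len d \<alpha> \<beta> \<gamma> =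
     (SUP (n, t) \<in> subdivisions \<alpha> \<beta>. ennreal (\<Sum>i = 1..n. d (\<gamma> (t (i - 1))) (\<gamma> (t i))))"

text \<open>The infimum over the empty set of curves is \<open>\<infinity>\<close>.\<close>

definition geodesic_dist :: "'m set \<Rightarrow> ('m \<Rightarrow> 'm \<Rightarrow> real) \<Rightarrow> 'm \<Rightarrow> 'm \<Rightarrow> ennreal" where
  "geodesic_dist M d x y =
     Inf {curve_len d \<alpha> \<beta> \<gamma> |\<alpha> \<beta> \<gamma>. curve_in M d \<alpha> \<beta> \<gamma> \<and> connects \<alpha> \<beta> \<gamma> x y}"

definition minimal_geodesic ::
  "'m set \<Rightarrow> ('m \<Rightarrow> 'm \<Rightarrow> real) \<Rightarrow> 'm \<Rightarrow> 'm \<Rightarrow> real \<Rightarrow> real \<Rightarrow> (real \<Rightarrow> 'm) \<Rightarrow> bool" where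
  "minimal_geodesic M d x y \<alpha> \<beta> \<gamma> \<longleftrightarrow>
     curve_in M d \<alpha> \<beta> \<gamma> \<and> connects \<alpha> \<beta> \<gamma> x y \<and> curve_len d \<alpha> \<beta> \<gamma> = geodesic_dist M d x y"

section \<open>The metrics \<open>d\<^sub>p\<^sub>,\<^sub>\<phi>\<close> on nonempty compact sets\<close>

definition in_Lp :: "real \<Rightarrow> ('a::euclidean_space \<Rightarrow> real) \<Rightarrow> bool" where
  "in_Lp p f \<longleftrightarrow>
     f \<in> borel_measurable lebesgue \<and> integrable lebesgue (\<lambda>x. \<bar>f x\<bar> powr p)"

definition Lp_norm :: "real \<Rightarrow> ('a::euclidean_space \<Rightarrow> real) \<Rightarrow> real" where
  "Lp_norm p f = (\<integral>x. \<bar>f x\<bar> powr p \<partial>lebesgue) powr (1 / p)"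

text \<open>Functions on \<open>[0,\<infinity>)\<close> are represented by total functions whose values at negative arguments
  are irrelevant. Hence the derivative is taken within \<open>[0,\<infinity>)\<close>, one-sided at \<open>0\<close>.\<close>

definition half_line_deriv :: "(real \<Rightarrow> real) \<Rightarrow> real \<Rightarrow> real" where
  "half_line_deriv \<phi> r = vector_derivative \<phi> (at r within {0..})"

text \<open>The type argument supplies the space \<open>\<real>\<^sup>N\<close>, on whose dimension admissibility depends.\<close>

definition admissible :: "'a::euclidean_space itself \<Rightarrow> real \<Rightarrow> (real \<Rightarrow> real) \<Rightarrow> bool" where
  "admissible TYPE('a) p \<phi> \<longleftrightarrow>
     (\<forall>r\<ge>0. \<phi> r > 0) \<and>
     strict_antimono_on {0..} \<phi> \<and>
     \<phi> differentiable_on {0..} \<and> continuous_on {0..} (half_line_deriv \<phi>) \<and>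
     in_Lp p (\<lambda>x::'a. \<phi> (norm x))"

definition compacts :: "'a::euclidean_space set set" where
  "compacts = {A. compact A \<and> A \<noteq> {}}"

text \<open>For nonempty \<open>A\<close>, \<open>infdist x A\<close> is the distance function \<open>u\<^sub>A(x)\<close>.\<close>

definition dist_p\<phi> ::
  "real \<Rightarrow> (real \<Rightarrow> real) \<Rightarrow> 'a::euclidean_space set \<Rightarrow> 'a set \<Rightarrow> real" where
  "dist_p\<phi> p \<phi> A B = Lp_norm p (\<lambda>x. \<phi> (infdist x A) - \<phi> (infdist x B))"

definition geod_p\<phi> ::
  "real \<Rightarrow> (real \<Rightarrow> real) \<Rightarrow> 'a::euclidean_space set \<Rightarrow> 'a set \<Rightarrow> ennreal" where
  "geod_p\<phi> p \<phi> = geodesic_dist compacts (dist_p\<phi> p \<phi>)"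

end

theory Submission
  imports Defs "HOL-Complex_Analysis.Great_Picard"
begin

text \<open>
  The proof is that of the Hopf-Rinow theorem in a space whose closed balls need not be compact:
  compact sets can drift to infinity at bounded distance in \<open>d\<close>. What replaces properness is a step
  size \<open>c > 0\<close>, valid everywhere: if \<open>A\<close> lies in the ball of radius \<open>R\<close> around the origin and
  \<open>d A B < c\<close>, then \<open>B\<close> lies in the ball of radius \<open>R + 3\<close>. Indeed, near a point of \<open>B\<close> far from \<open>A\<close> the
  function \<open>\<phi> \<circ> u\<^sub>B\<close> exceeds \<open>\<phi> \<circ> u\<^sub>A\<close> by a fixed amount on a ball of fixed size
  (\<open>separation_le_dist\<close>). Since a curve of length \<open>L\<close> consists of finitely many pieces shorter than \<open>c\<close>,
  their number depending on \<open>L\<close> only, all curves of length at most \<open>L\<close> from \<open>A\<close> run inside one ball of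
  the Euclidean space. The nonempty compact subsets of a ball are compact for \<open>d\<close>, by Blaschke
  selection and dominated convergence (\<open>compactin_bounded_compacts\<close>).

  Inside a compact set, curves of bounded length have limits. A curve of length at most \<open>L\<close> is
  sampled finely and turned into a step function on \<open>[0, L]\<close> that is \<open>1\<close>-Lipschitz up to an error
  \<open>\<epsilon>\<close>; Tychonoff's theorem yields a function that is \<open>1\<close>-Lipschitz up to every positive error
  (\<open>short_curve_limit\<close>). Consequently the geodesic distance is at most \<open>L\<close> exactly when some
  \<open>1\<close>-Lipschitz curve of duration \<open>L\<close> joins the two points (\<open>geodesic_dist_le_iff\<close>), and it is lower
  semicontinuous for \<open>d\<close>. This makes geodesic balls closed subsets of compact sets, provides minimal
  geodesics, and lets the sum of squared distances attain its minimum.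

  When the geodesic distance of \<open>A\<close> and \<open>B\<close> is infinite, a minimal geodesic is any continuous curve;
  one is given by the sets of all \<open>(1 - t) a + t b\<close> with \<open>a \<in> A\<close> and \<open>b \<in> B\<close>.
\<close>

section \<open>Curves of speed at most one and their limits\<close>

context Metric_space
begin

text \<open>For \<open>\<epsilon> = 0\<close> and \<open>x, y \<in> M\<close> these are the \<open>1\<close>-Lipschitz curves of duration \<open>L\<close> from \<open>x\<close> to \<open>y\<close>. The
  additive error \<open>\<epsilon>\<close>, in the speed bound and at both endpoints, admits discontinuous step
  functions along a fine chain of points, which spares the reparametrization of a curve of given
  length by arc length. All conditions are closed, so they survive pointwise limits.\<close>

definition short_curve :: "real \<Rightarrow> real \<Rightarrow> (real \<Rightarrow> 'a) \<Rightarrow> 'a \<Rightarrow> 'a \<Rightarrow> bool" where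
  "short_curve \<epsilon> L \<gamma> x y \<longleftrightarrow>
     \<gamma> ` {0..L} \<subseteq> M \<and> (\<forall>s\<in>{0..L}. \<forall>t\<in>{0..L}. d (\<gamma> s) (\<gamma> t) \<le> \<bar>s - t\<bar> + \<epsilon>) \<and>
     d x (\<gamma> 0) \<le> \<epsilon> \<and> d (\<gamma> L) y \<le> \<epsilon>"

lemma short_curve_mono: "short_curve \<epsilon> L \<gamma> x y \<Longrightarrow> \<epsilon> \<le> \<epsilon>' \<Longrightarrow> short_curve \<epsilon>' L \<gamma> x y"
  unfolding short_curve_def by fastforce

lemma short_curve_reverse:
  assumes "short_curve \<epsilon> L \<gamma> x y"
  shows "short_curve \<epsilon> L (\<lambda>s. \<gamma> (L - s)) y x"
proof -
  have "d (\<gamma> (L - s)) (\<gamma> (L - t)) \<le> \<bar>s - t\<bar> + \<epsilon>" if "s \<in> {0..L}" "t \<in> {0..L}" for s t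
  proof -
    have "d (\<gamma> (L - s)) (\<gamma> (L - t)) \<le> \<bar>(L - s) - (L - t)\<bar> + \<epsilon>"
      using assms that unfolding short_curve_def by (metis atLeastAtMost_iff diff_ge_0_iff_ge diff_le_eq le_add_same_cancel1)
    then show ?thesis by (simp add: abs_minus_commute)
  qed
  moreover have "(\<lambda>s. \<gamma> (L - s)) ` {0..L} \<subseteq> M"
    using assms unfolding short_curve_def by force
  ultimately show ?thesis
    using assms unfolding short_curve_def by (simp add: commute)
qed

text \<open>A shorter duration truncates the curve, a longer one lets it rest at its endpoint.\<close>

lemma short_curve_change_length:
  assumes \<gamma>: "short_curve \<epsilon> L \<gamma> x y" and y: "y \<in> M" and L: "0 \<le> L" "0 \<le> L'"
  shows "short_curve (2 * \<epsilon> + \<bar>L - L'\<bar>) L' (\<lambda>s. \<gamma> (min s L)) x y"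
proof -
  have \<epsilon>: "0 \<le> \<epsilon>"
    using \<gamma> nonneg[of x "\<gamma> 0"] unfolding short_curve_def by linarith
  have lip: "d (\<gamma> s) (\<gamma> t) \<le> \<bar>s - t\<bar> + \<epsilon>" if "s \<in> {0..L}" "t \<in> {0..L}" for s t
    using \<gamma> that unfolding short_curve_def by blast
  have "d (\<gamma> (min s L)) (\<gamma> (min t L)) \<le> \<bar>s - t\<bar> + (2 * \<epsilon> + \<bar>L - L'\<bar>)"
    if "s \<in> {0..L'}" "t \<in> {0..L'}" for s t
    using lip[of "min s L" "min t L"] that L \<epsilon> by (auto simp: min_def split: if_splits)
  moreover have "(\<lambda>s. \<gamma> (min s L)) ` {0..L'} \<subseteq> M"
  proof -
    have "min s L \<in> {0..L}" if "s \<in> {0..L'}" for s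
      using that L by auto
    then show ?thesis
      using \<gamma> unfolding short_curve_def by blast
  qed
  moreover have "d (\<gamma> (min L' L)) y \<le> 2 * \<epsilon> + \<bar>L - L'\<bar>"
  proof -
    have "\<gamma> (min L' L) \<in> M" "\<gamma> L \<in> M"
      using \<gamma> L unfolding short_curve_def by (auto simp: image_subset_iff)
    then have "d (\<gamma> (min L' L)) y \<le> d (\<gamma> (min L' L)) (\<gamma> L) + d (\<gamma> L) y"
      using triangle y by blast
    moreover have "d (\<gamma> (min L' L)) (\<gamma> L) \<le> \<bar>L - L'\<bar> + \<epsilon>"
      using lip[of "min L' L" L] L by (auto simp: min_def split: if_splits)
    moreover have "d (\<gamma> L) y \<le> \<epsilon>"
      using \<gamma> unfolding short_curve_def by blast
    ultimately show ?thesis by linarith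
  qed
  ultimately show ?thesis
    using \<gamma> L \<epsilon> unfolding short_curve_def by auto
qed

lemma short_curve_move_end:
  assumes "short_curve \<epsilon> L \<gamma> x y" "0 \<le> L" "y \<in> M" "z \<in> M" "d y z \<le> \<delta>"
  shows "short_curve (\<epsilon> + \<delta>) L \<gamma> x z"
proof -
  have "\<gamma> L \<in> M"
    using assms unfolding short_curve_def by (auto simp: image_subset_iff)
  then have "d (\<gamma> L) z \<le> \<epsilon> + \<delta>"
    using triangle[of "\<gamma> L" y z] assms unfolding short_curve_def by fastforce
  moreover have "0 \<le> \<delta>"
    using assms(5) nonneg[of y z] by linarith
  ultimately show ?thesis
    using assms unfolding short_curve_def by fastforce
qed

lemma curve_inI:
  assumes "\<alpha> \<le> \<beta>" and M: "\<gamma> ` {\<alpha>..\<beta>} \<subseteq> M"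
    and lim: "\<And>t. t \<in> {\<alpha>..\<beta>} \<Longrightarrow> ((\<lambda>s. d (\<gamma> t) (\<gamma> s)) \<longlongrightarrow> 0) (at t within {\<alpha>..\<beta>})"
  shows "curve_in M d \<alpha> \<beta> \<gamma>"
  unfolding curve_in_def continuous_map_to_metric
proof (intro conjI ballI allI impI)
  fix t and e :: real
  assume "t \<in> topspace (top_of_set {\<alpha>..\<beta>})" "0 < e"
  then have t: "t \<in> {\<alpha>..\<beta>}" by simp
  have "\<forall>\<^sub>F s in at t within {\<alpha>..\<beta>}. d (\<gamma> t) (\<gamma> s) < e"
    using lim[OF t] \<open>0 < e\<close> by (auto simp: tendsto_iff)
  then obtain U where U: "open U" "t \<in> U" "\<forall>s\<in>U. s \<noteq> t \<longrightarrow> s \<in> {\<alpha>..\<beta>} \<longrightarrow> d (\<gamma> t) (\<gamma> s) < e"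
    unfolding eventually_at_topological by blast
  have "d (\<gamma> t) (\<gamma> t) = 0"
    using M t by (auto simp: image_subset_iff)
  then have "\<forall>s\<in>{\<alpha>..\<beta>} \<inter> U. \<gamma> s \<in> mball (\<gamma> t) e"
    using U M t \<open>0 < e\<close> unfolding in_mball by (metis IntE image_subset_iff)
  then show "\<exists>U. openin (top_of_set {\<alpha>..\<beta>}) U \<and> t \<in> U \<and> (\<forall>s\<in>U. \<gamma> s \<in> mball (\<gamma> t) e)"
    using U(1,2) t by (meson IntI openin_open_Int)
qed fact

lemma short_curve_0D:
  assumes \<gamma>: "short_curve 0 L \<gamma> x y" and xy: "x \<in> M" "y \<in> M" and L: "0 \<le> L"
  shows "curve_in M d 0 L \<gamma>" "connects 0 L \<gamma> x y" "curve_len d 0 L \<gamma> \<le> ennreal L"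
proof -
  have M: "\<gamma> ` {0..L} \<subseteq> M" and lip: "\<And>s t. s \<in> {0..L} \<Longrightarrow> t \<in> {0..L} \<Longrightarrow> d (\<gamma> s) (\<gamma> t) \<le> \<bar>s - t\<bar>"
    using \<gamma> unfolding short_curve_def by auto
  show "curve_in M d 0 L \<gamma>"
  proof (rule curve_inI[OF L M])
    fix t assume t: "t \<in> {0..L}"
    have "((\<lambda>s. \<bar>t - s\<bar>) \<longlongrightarrow> \<bar>t - t\<bar>) (at t within {0..L})"
      by (intro tendsto_intros)
    moreover have "\<forall>\<^sub>F s in at t within {0..L}. d (\<gamma> t) (\<gamma> s) \<le> \<bar>t - s\<bar>"
      unfolding eventually_at using lip t by (auto intro!: exI[of _ 1])
    ultimately show "((\<lambda>s. d (\<gamma> t) (\<gamma> s)) \<longlongrightarrow> 0) (at t within {0..L})"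
      using tendsto_sandwich[of "\<lambda>_. 0" "\<lambda>s. d (\<gamma> t) (\<gamma> s)" _ "\<lambda>s. \<bar>t - s\<bar>" 0] by simp
  qed
  have "\<gamma> 0 \<in> M" "\<gamma> L \<in> M"
    using M L by (auto simp: image_subset_iff)
  moreover have "d x (\<gamma> 0) = 0" "d (\<gamma> L) y = 0"
    using \<gamma> unfolding short_curve_def by (simp_all add: order_antisym)
  ultimately show "connects 0 L \<gamma> x y"
    using xy by (simp add: connects_def)
  have "(\<Sum>i = 1..n. d (\<gamma> (t (i - 1))) (\<gamma> (t i))) \<le> L"
    if mono: "mono_on {0..n} t" and t: "t ` {0..n} \<subseteq> {0..L}" for n and t :: "nat \<Rightarrow> real"
  proof -
    have "d (\<gamma> (t (i - 1))) (\<gamma> (t i)) \<le> t i - t (i - 1)" if "i \<in> {1..n}" for i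
    proof -
      have "i - 1 \<in> {0..n}" "i \<in> {0..n}" using that by auto
      moreover from this have "t (i - 1) \<le> t i" using mono by (auto intro: mono_onD)
      moreover have "t (i - 1) \<in> {0..L}" "t i \<in> {0..L}" 
        using t calculation by blast+
      ultimately show ?thesis
        using lip[of "t (i - 1)" "t i"] by linarith
    qed
    then have "(\<Sum>i = 1..n. d (\<gamma> (t (i - 1))) (\<gamma> (t i))) \<le> (\<Sum>i = 1..n. t i - t (i - 1))"
      by (rule sum_mono)
    also have "\<dots> = t n - t 0"
      by (induction n) auto
    also have "\<dots> \<le> L"
    proof -
      have "t n \<in> {0..L}" "t 0 \<in> {0..L}"
        using t by (auto simp: image_subset_iff)
      then show ?thesis by simp
    qed
    finally show ?thesis .
  qed
  then show "curve_len d 0 L \<gamma> \<le> ennreal L"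
    unfolding curve_len_def subdivisions_def using L
    by (auto intro!: SUP_least ennreal_leI)
qed

lemma chain_dist_le:
  assumes "\<And>i. x i \<in> M" "i \<le> j"
  shows "d (x i) (x j) \<le> (\<Sum>k<j. d (x k) (x (Suc k))) - (\<Sum>k<i. d (x k) (x (Suc k)))"
  using \<open>i \<le> j\<close>
proof (induction j rule: dec_induct)
  case base
  then show ?case using assms(1) by simp
next
  case (step j)
  then show ?case
    using triangle[of "x i" "x j" "x (Suc j)"] assms(1) by simp
qed

text \<open>At time \<open>s\<close> the curve sits at the last point of the chain whose distance from \<open>x 0\<close> measured
  along the chain is at most \<open>s\<close>. The steps being at most \<open>\<epsilon>\<close> long, that length lies within
  \<open>\<epsilon>\<close> of \<open>s\<close> as long as the end of the chain is not reached.\<close>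

lemma short_curve_of_chain:
  fixes x :: "nat \<Rightarrow> 'a"
  assumes x: "\<And>i. x i \<in> M" and L: "(\<Sum>k<n. d (x k) (x (Suc k))) \<le> L"
    and step: "\<And>k. k < n \<Longrightarrow> d (x k) (x (Suc k)) \<le> \<epsilon>" and \<epsilon>: "0 \<le> \<epsilon>"
  shows "\<exists>\<gamma>. short_curve \<epsilon> L \<gamma> (x 0) (x n)"
proof -
  define S where "S i = (\<Sum>k<i. d (x k) (x (Suc k)))" for i
  define k where "k s = Max {i. i \<le> n \<and> S i \<le> s}" for s
  have fin: "finite {i. i \<le> n \<and> S i \<le> s}" for s
    by simp
  have k: "k s \<le> n" "S (k s) \<le> s" if "0 \<le> s" for s
  proof -
    have "0 \<in> {i. i \<le> n \<and> S i \<le> s}"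
      using that by (simp add: S_def)
    then have "k s \<in> {i. i \<le> n \<and> S i \<le> s}"
      unfolding k_def by (intro Max_in fin) auto
    then show "k s \<le> n" "S (k s) \<le> s" by auto
  qed
  have k_max: "i \<le> k s" if "i \<le> n" "S i \<le> s" for i s
    unfolding k_def using that by (intro Max_ge fin) auto
  have dS: "d (x i) (x j) \<le> S j - S i" if "i \<le> j" for i j
    using chain_dist_le[of x, OF x that] by (simp add: S_def)
  have le: "d (x (k s)) (x (k t)) \<le> t - s + \<epsilon>" if st: "0 \<le> s" "s \<le> t" for s t
  proof -
    have kst: "k s \<le> k t"
      using k[of s] st by (intro k_max) auto
    show ?thesis
    proof (cases "k s = n")
      case True
      then have "k t = n"
        using kst k(1)[of t] st by simp
      then show ?thesis
        using True st \<epsilon> x by simp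
    next
      case False
      then have lt: "k s < n"
        using k(1)[of s] st by simp
      then have "s < S (Suc (k s))"
        using k_max[of "Suc (k s)" s] by force
      also have "\<dots> \<le> S (k s) + \<epsilon>"
        using step[OF lt] by (simp add: S_def)
      finally show ?thesis
        using dS[OF kst] k(2)[of t] st by linarith
    qed
  qed
  have "d (x (k s)) (x (k t)) \<le> \<bar>s - t\<bar> + \<epsilon>" if "s \<in> {0..L}" "t \<in> {0..L}" for s t
    using le[of s t] le[of t s] commute[of "x (k s)" "x (k t)"] that by (cases "s \<le> t") auto
  moreover have "d (x 0) (x (k 0)) \<le> \<epsilon>"
    using dS[of 0 "k 0"] k(2)[of 0] \<epsilon> by (simp add: S_def)
  moreover have "k L = n"
  proof -
    have "0 \<le> L" using L by (meson dual_order.trans nonneg sum_nonneg)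
    then show ?thesis
      using k(1)[of L] k_max[of n L] L by (simp add: S_def)
  qed
  ultimately have "short_curve \<epsilon> L (\<lambda>s. x (k s)) (x 0) (x n)"
    using x \<epsilon> unfolding short_curve_def by auto
  then show ?thesis by blast
qed

text \<open>Uniform continuity turns an equidistant subdivision of \<open>[\<alpha>, \<beta>]\<close> into a chain with steps below
  \<open>\<epsilon>\<close>, and the length of the curve bounds the length of the chain.\<close>

lemma short_curve_of_curve:
  assumes \<gamma>: "curve_in M d \<alpha> \<beta> \<gamma>" "connects \<alpha> \<beta> \<gamma> x y"
    and len: "curve_len d \<alpha> \<beta> \<gamma> \<le> ennreal L" and L: "0 \<le> L" and \<epsilon>: "0 < \<epsilon>"
  shows "\<exists>\<gamma>'. short_curve \<epsilon> L \<gamma>' x y"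
proof -
  have \<alpha>\<beta>: "\<alpha> \<le> \<beta>" and cont: "continuous_map (top_of_set {\<alpha>..\<beta>}) mtopology \<gamma>"
    using \<gamma>(1) by (auto simp: curve_in_def)
  have M: "\<gamma> t \<in> M" if "t \<in> {\<alpha>..\<beta>}" for t
    using continuous_map_image_subset_topspace[OF cont] that by (auto simp: image_subset_iff)
  let ?I = "submetric euclidean_metric {\<alpha>..\<beta>}"
  have top: "mtopology_of ?I = top_of_set {\<alpha>..\<beta>}"
    by (simp add: mtopology_of_submetric)
  have "uniformly_continuous_map ?I (metric (M, d)) \<gamma>"
  proof (rule continuous_imp_uniformly_continuous_map, intro conjI)
    show "compact_space (mtopology_of ?I)"
      unfolding top by (simp add: compact_space_subtopology)
    show "continuous_map (mtopology_of ?I) (mtopology_of (metric (M, d))) \<gamma>"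
      unfolding top using cont by (simp add: mtopology_of_def)
  qed
  then obtain \<delta> where \<delta>: "\<delta> > 0"
    "\<And>s t. s \<in> {\<alpha>..\<beta>} \<Longrightarrow> t \<in> {\<alpha>..\<beta>} \<Longrightarrow> \<bar>t - s\<bar> < \<delta> \<Longrightarrow> d (\<gamma> t) (\<gamma> s) < \<epsilon>"
    using \<epsilon> unfolding uniformly_continuous_map_def by (force simp: dist_real_def)
  obtain n :: nat where n: "n > 0" "(\<beta> - \<alpha>) / \<delta> < n"
  proof -
    obtain m :: nat where "(\<beta> - \<alpha>) / \<delta> < m"
      using reals_Archimedean2 by blast
    then show ?thesis
      by (intro that[of "Suc m"]) auto
  qed
  \<comment> \<open>Beyond \<open>n\<close> the subdivision is constant, so that every index gives a point of \<open>[\<alpha>, \<beta>]\<close>.\<close>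
  define t where "t i = (if i \<le> n then \<alpha> + (\<beta> - \<alpha>) * i / n else \<beta>)" for i :: nat
  have t: "t i \<in> {\<alpha>..\<beta>}" for i
  proof (cases "i \<le> n")
    case True
    have "(\<beta> - \<alpha>) * i / n \<le> (\<beta> - \<alpha>) * 1"
      using True n \<alpha>\<beta> unfolding times_divide_eq_right[symmetric] by (intro mult_left_mono) auto
    then show ?thesis
      using True n \<alpha>\<beta> by (auto simp: t_def)
  qed (use \<alpha>\<beta> in \<open>auto simp: t_def\<close>)
  have t_diff: "t (Suc i) - t i = (\<beta> - \<alpha>) / n" if "i < n" for i
    using that n by (simp add: t_def field_simps)
  have sub: "(n, t) \<in> subdivisions \<alpha> \<beta>"
  proof -
    have "mono_on {0..n} t"
      using \<alpha>\<beta> by (auto simp: mono_on_def t_def intro!: divide_right_mono mult_left_mono)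
    then show ?thesis
      using t by (auto simp: subdivisions_def)
  qed
  have shift: "(\<Sum>i = 1..n. d (\<gamma> (t (i - 1))) (\<gamma> (t i))) = (\<Sum>i<n. d (\<gamma> (t i)) (\<gamma> (t (Suc i))))"
    by (simp add: sum.atLeast1_atMost_eq)
  have "ennreal (\<Sum>i<n. d (\<gamma> (t i)) (\<gamma> (t (Suc i)))) \<le> curve_len d \<alpha> \<beta> \<gamma>"
    unfolding curve_len_def shift[symmetric] using sub by (rule SUP_upper2) auto
  then have "(\<Sum>i<n. d (\<gamma> (t i)) (\<gamma> (t (Suc i)))) \<le> L"
    using len L by (meson ennreal_le_iff order_trans)
  moreover have "d (\<gamma> (t i)) (\<gamma> (t (Suc i))) \<le> \<epsilon>" if "i < n" for i
  proof -
    have "(\<beta> - \<alpha>) / n < \<delta>"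
      using n \<delta>(1) by (simp add: field_simps)
    then have "\<bar>t i - t (Suc i)\<bar> < \<delta>"
      using t_diff[OF that] \<alpha>\<beta> divide_nonneg_nonneg[of "\<beta> - \<alpha>" n] by linarith
    then show ?thesis
      using \<delta>(2)[OF t t] by (simp add: less_imp_le)
  qed
  ultimately have "\<exists>\<gamma>'. short_curve \<epsilon> L \<gamma>' (\<gamma> (t 0)) (\<gamma> (t n))"
    using short_curve_of_chain[of "\<lambda>i. \<gamma> (t i)" n L \<epsilon>] M t \<epsilon> by (simp add: less_imp_le)
  moreover have "t 0 = \<alpha>" "t n = \<beta>"
    using n by (auto simp: t_def)
  ultimately show ?thesis
    using \<gamma>(2) by (simp add: connects_def)
qed

text \<open>The functions from \<open>[0, L]\<close> to \<open>K\<close> form a compact space under pointwise convergence, by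
  Tychonoff's theorem. The \<open>\<epsilon>\<close>-short ones are closed in it, because each of their defining
  inequalities involves at most two values of the function, and they decrease with \<open>\<epsilon>\<close>. Hence some
  function is \<open>\<epsilon>\<close>-short for all \<open>\<epsilon> > 0\<close>.\<close>

lemma short_curve_limit:
  assumes K: "compactin mtopology K" and xy: "x \<in> M" "y \<in> M" and L: "0 \<le> L"
    and ex: "\<And>\<epsilon>. 0 < \<epsilon> \<Longrightarrow> \<exists>\<gamma>. short_curve \<epsilon> L \<gamma> x y \<and> \<gamma> ` {0..L} \<subseteq> K"
  shows "\<exists>\<gamma>. short_curve 0 L \<gamma> x y"
proof -
  have KM: "K \<subseteq> M"
    using compactin_subset_topspace[OF K] by simp
  define X where "X = product_topology (\<lambda>_::real. subtopology mtopology K) {0..L}"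
  have topX: "topspace X = ({0..L} \<rightarrow>\<^sub>E K)"
    using KM by (simp add: X_def Int_absorb1)
  have "compact_space (subtopology mtopology K)"
    using K by (simp add: compact_space_subtopology)
  then have X: "compact_space X"
    unfolding X_def compact_space_product_topology by simp
  define C where "C n = {\<gamma> \<in> topspace X. short_curve (1 / Suc n) L \<gamma> x y}" for n
  have proj: "continuous_map X mtopology (\<lambda>\<gamma>. \<gamma> s)" if "s \<in> {0..L}" for s
    using continuous_map_product_projection[OF that, of "\<lambda>_. subtopology mtopology K"]
    unfolding X_def by (rule continuous_map_into_fulltopology)
  have cont_d: "continuous_map X euclideanreal (\<lambda>\<gamma>. d (f \<gamma>) (g \<gamma>))"
    if "continuous_map X mtopology f" "continuous_map X mtopology g" for f g
    using continuous_map_mdist[of X "metric (M, d)" f g] that by (simp add: mtopology_of_def)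
  have closed: "closedin X {\<gamma> \<in> topspace X. d (f \<gamma>) (g \<gamma>) \<le> c}"
    if "continuous_map X mtopology f" "continuous_map X mtopology g" for f g c
    using closedin_continuous_map_preimage[OF cont_d[OF that], of "{..c}"] by simp
  have inM: "\<gamma> ` {0..L} \<subseteq> M" if "\<gamma> \<in> topspace X" for \<gamma>
    using that KM unfolding topX by (auto simp: PiE_iff)
  have "closedin X (C n)" for n
  proof -
    have eq: "C n = topspace X \<inter> (\<Inter>s\<in>{0..L}. \<Inter>t\<in>{0..L}. {\<gamma> \<in> topspace X. d (\<gamma> s) (\<gamma> t) \<le> \<bar>s - t\<bar> + 1 / Suc n})
        \<inter> {\<gamma> \<in> topspace X. d x (\<gamma> 0) \<le> 1 / Suc n} \<inter> {\<gamma> \<in> topspace X. d (\<gamma> L) y \<le> 1 / Suc n}"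
      using inM unfolding C_def short_curve_def by blast
    show ?thesis
      unfolding eq using L xy
      by (intro closedin_Int closedin_INT closed proj closedin_topspace) (auto intro!: proj)
  qed
  moreover have "C n \<noteq> {}" for n
  proof -
    obtain \<gamma> where "short_curve (1 / Suc n) L \<gamma> x y" "\<gamma> ` {0..L} \<subseteq> K"
      using ex[of "1 / Suc n"] by auto
    then have "restrict \<gamma> {0..L} \<in> C n"
      using L unfolding C_def topX by (auto simp: short_curve_def)
    then show ?thesis by blast
  qed
  moreover have "decseq C"
    unfolding decseq_def C_def by (auto elim!: short_curve_mono simp: frac_le)
  ultimately have "(\<Inter>n. C n) \<noteq> {}"
    by (rule compact_space_imp_nest[OF X])
  then obtain \<gamma> where \<gamma>: "\<And>n. short_curve (1 / Suc n) L \<gamma> x y"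
    unfolding C_def by auto
  have le: "a \<le> b" if "\<And>n. a \<le> b + 1 / Suc n" for a b :: real
  proof (rule field_le_epsilon)
    fix e :: real assume "0 < e"
    then obtain n where "1 / Suc n < e"
      using nat_approx_posE by blast
    then show "a \<le> b + e"
      using that[of n] by linarith
  qed
  have "d (\<gamma> s) (\<gamma> t) \<le> \<bar>s - t\<bar>" if "s \<in> {0..L}" "t \<in> {0..L}" for s t
    by (rule le) (use \<gamma> that in \<open>unfold short_curve_def, blast\<close>)
  moreover have "d x (\<gamma> 0) \<le> 0" "d (\<gamma> L) y \<le> 0"
    by (rule le; use \<gamma> in \<open>simp add: short_curve_def\<close>)+
  moreover have "\<gamma> ` {0..L} \<subseteq> M"
    using \<gamma> unfolding short_curve_def by blast
  ultimately have "short_curve 0 L \<gamma> x y"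
    unfolding short_curve_def by auto
  then show ?thesis by blast
qed


lemma geodesic_dist_le_of_short_curve:
  assumes "short_curve 0 L \<gamma> x y" "x \<in> M" "y \<in> M" "0 \<le> L"
  shows "geodesic_dist M d x y \<le> ennreal L"
proof -
  have "geodesic_dist M d x y \<le> curve_len d 0 L \<gamma>"
    unfolding geodesic_dist_def using short_curve_0D(1,2)[OF assms] by (intro Inf_lower) blast
  then show ?thesis
    using short_curve_0D(3)[OF assms] by (rule order_trans)
qed

lemma short_curve_of_geodesic_dist:
  assumes le: "geodesic_dist M d x y \<le> ennreal L" and L: "0 \<le> L" and y: "y \<in> M" and \<epsilon>: "0 < \<epsilon>"
  shows "\<exists>\<gamma>. short_curve \<epsilon> L \<gamma> x y"
proof -
  have "geodesic_dist M d x y < ennreal (L + \<epsilon> / 4)"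
    using ennreal_lessI[of "L + \<epsilon> / 4" L] L \<epsilon> by (intro le_less_trans[OF le]) simp
  then obtain \<alpha> \<beta> \<gamma> where \<gamma>: "curve_in M d \<alpha> \<beta> \<gamma>" "connects \<alpha> \<beta> \<gamma> x y"
    "curve_len d \<alpha> \<beta> \<gamma> < ennreal (L + \<epsilon> / 4)"
    unfolding geodesic_dist_def Inf_less_iff by blast
  obtain \<gamma>' where "short_curve (\<epsilon> / 4) (L + \<epsilon> / 4) \<gamma>' x y"
    using short_curve_of_curve[OF \<gamma>(1,2) less_imp_le[OF \<gamma>(3)], of "\<epsilon> / 4"] L \<epsilon> by auto
  from short_curve_change_length[OF this y, of L]
  have "short_curve (2 * (\<epsilon> / 4) + \<bar>L + \<epsilon> / 4 - L\<bar>) L (\<lambda>s. \<gamma>' (min s (L + \<epsilon> / 4))) x y"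
    using L \<epsilon> by simp
  then show ?thesis
    using \<epsilon> by (intro exI) (erule short_curve_mono, simp)
qed

end

section \<open>Geodesic balls when bounded steps stay in compact sets\<close>

text \<open>The constant \<open>c\<close> is the same at all points. A curve of length \<open>L\<close> splits into about \<open>2 L / c\<close>
  pieces shorter than \<open>c\<close>, so it stays in a compact set that depends only on \<open>L\<close> and on its
  starting point.\<close>

locale step_exhausted_metric = Metric_space +
  fixes K :: "nat \<Rightarrow> 'a set" and c :: real
  assumes step_pos: "0 < c"
    and compact_K: "\<And>n. compactin mtopology (K n)"
    and exhausts: "M \<subseteq> (\<Union>n. K n)"
    and step_K: "\<And>n x y. x \<in> K n \<Longrightarrow> y \<in> M \<Longrightarrow> d x y < c \<Longrightarrow> y \<in> K (Suc n)"
begin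

text \<open>Moving for time \<open>c / 2\<close> along a curve with error \<open>\<epsilon> \<le> c / 4\<close> displaces it by less than \<open>c\<close>, hence by
  at most one level of the exhaustion.\<close>

lemma short_curve_bounded:
  assumes "x \<in> M" "0 \<le> L"
  obtains n where "\<And>\<epsilon> \<gamma> y. short_curve \<epsilon> L \<gamma> x y \<Longrightarrow> \<epsilon> \<le> c / 4 \<Longrightarrow> \<gamma> ` {0..L} \<subseteq> K n"
proof -
  obtain m where m: "x \<in> K m"
    using exhausts assms by blast
  have reach: "\<gamma> s \<in> K (m + n + 1)"
    if \<gamma>: "short_curve \<epsilon> L \<gamma> x y" and \<epsilon>: "\<epsilon> \<le> c / 4" and s: "s \<in> {0..L}" "s \<le> n * (c / 2)"
    for \<epsilon> \<gamma> y s n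
    using s
  proof (induction n arbitrary: s)
    case 0
    then have "s = 0" by simp
    moreover have "d x (\<gamma> 0) < c" "\<gamma> 0 \<in> M"
      using \<gamma> \<epsilon> step_pos assms(2) unfolding short_curve_def by (auto simp: image_subset_iff)
    ultimately show ?case
      using step_K[OF m] by simp
  next
    case (Suc n)
    define s' where "s' = max 0 (s - c / 2)"
    have s': "s' \<in> {0..L}" "s' \<le> n * (c / 2)"
      using Suc.prems step_pos mult_nonneg_nonneg[of "real n" "c / 2"]
      by (auto simp: s'_def max_def algebra_simps)
    have "d (\<gamma> s') (\<gamma> s) \<le> \<bar>s' - s\<bar> + \<epsilon>" "\<gamma> s \<in> M"
      using \<gamma> s' Suc.prems unfolding short_curve_def by (blast, auto)
    moreover have "\<bar>s' - s\<bar> \<le> c / 2"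
      using Suc.prems step_pos by (auto simp: s'_def max_def)
    ultimately have "d (\<gamma> s') (\<gamma> s) < c" 
      using \<epsilon> step_pos by linarith
    then show ?case
      using step_K[OF Suc.IH[OF s']] \<open>\<gamma> s \<in> M\<close> by simp
  qed
  obtain n :: nat where "L / (c / 2) \<le> n"
    using real_arch_simple by blast
  then have n: "L \<le> n * (c / 2)"
    using step_pos by (simp add: field_simps)
  show thesis
  proof (rule that[of "m + n + 1"])
    fix \<epsilon> \<gamma> y assume "short_curve \<epsilon> L \<gamma> x y" "\<epsilon> \<le> c / 4"
    then show "\<gamma> ` {0..L} \<subseteq> K (m + n + 1)"
      using reach n by fastforce
  qed
qed

lemma short_curve_limit_exhausted:
  assumes xy: "x \<in> M" "y \<in> M" and L: "0 \<le> L"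
    and ex: "\<And>\<epsilon>. 0 < \<epsilon> \<Longrightarrow> \<exists>\<gamma>. short_curve \<epsilon> L \<gamma> x y"
  shows "\<exists>\<gamma>. short_curve 0 L \<gamma> x y"
proof -
  obtain n where n: "\<And>\<epsilon> \<gamma> y. short_curve \<epsilon> L \<gamma> x y \<Longrightarrow> \<epsilon> \<le> c / 4 \<Longrightarrow> \<gamma> ` {0..L} \<subseteq> K n"
    using short_curve_bounded[OF xy(1) L] by blast
  show ?thesis
  proof (rule short_curve_limit[OF compact_K[of n] xy L])
    fix \<epsilon> :: real assume "0 < \<epsilon>"
    then obtain \<gamma> where "short_curve (min \<epsilon> (c / 4)) L \<gamma> x y"
      using ex[of "min \<epsilon> (c / 4)"] step_pos by auto
    then show "\<exists>\<gamma>. short_curve \<epsilon> L \<gamma> x y \<and> \<gamma> ` {0..L} \<subseteq> K n"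
      using n short_curve_mono by (meson min.cobounded1 min.cobounded2)
  qed
qed

text \<open>The infimum defining the geodesic distance is attained by a curve of speed at most one: curves
  of length close to \<open>L\<close> are replaced by short step functions, and these have a limit.\<close>

lemma geodesic_dist_le_iff:
  assumes "x \<in> M" "y \<in> M" "0 \<le> L"
  shows "geodesic_dist M d x y \<le> ennreal L \<longleftrightarrow> (\<exists>\<gamma>. short_curve 0 L \<gamma> x y)"
  using short_curve_limit_exhausted[OF assms] short_curve_of_geodesic_dist
    geodesic_dist_le_of_short_curve assms by blast

lemma geodesic_dist_commute:
  assumes "x \<in> M" "y \<in> M"
  shows "geodesic_dist M d x y = geodesic_dist M d y x"
proof -
  have le: "geodesic_dist M d y x \<le> geodesic_dist M d x y" if "x \<in> M" "y \<in> M" for x y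
  proof (cases "geodesic_dist M d x y")
    case (real L)
    then obtain \<gamma> where "short_curve 0 L \<gamma> x y"
      using geodesic_dist_le_iff[of x y L] \<open>x \<in> M\<close> \<open>y \<in> M\<close> by auto
    then show ?thesis
      using geodesic_dist_le_iff[of y x L] short_curve_reverse that real by fastforce
  qed simp
  then show ?thesis
    using assms by (simp add: order_antisym)
qed

text \<open>A curve of length \<open>L n\<close> ending at \<open>y n\<close> is an almost short curve of duration \<open>l\<close> ending at \<open>z\<close>, with
  error \<open>\<bar>L n - l\<bar> + d (y n) z\<close>.\<close>

lemma geodesic_dist_lower_semicontinuous:
  assumes x: "x \<in> M" and y: "limitin mtopology y z sequentially" and L: "L \<longlonglongrightarrow> l"
    and L0: "\<And>n. 0 \<le> L n" and le: "\<And>n. geodesic_dist M d x (y n) \<le> ennreal (L n)"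
  shows "geodesic_dist M d x z \<le> ennreal l"
proof -
  have z: "z \<in> M"
    using y by (simp add: limitin_metric)
  have l: "0 \<le> l"
    using LIMSEQ_le_const[OF L, of 0] L0 by blast
  have "\<exists>\<gamma>. short_curve \<epsilon> l \<gamma> x z" if \<epsilon>: "0 < \<epsilon>" for \<epsilon>
  proof -
    have "\<forall>\<^sub>F n in sequentially. y n \<in> M \<and> d (y n) z < \<epsilon> / 2"
      using y \<epsilon> unfolding limitin_metric by (meson half_gt_zero)
    moreover have "\<forall>\<^sub>F n in sequentially. dist (L n) l < \<epsilon> / 2"
      using L half_gt_zero[OF \<epsilon>] unfolding tendsto_iff by blast
    ultimately obtain n where n: "y n \<in> M" "d (y n) z < \<epsilon> / 2" "\<bar>L n - l\<bar> < \<epsilon> / 2"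
      using eventually_happens'[OF sequentially_bot eventually_conj] by (metis (mono_tags, lifting) dist_real_def)
    obtain \<gamma> where "short_curve 0 (L n) \<gamma> x (y n)"
      using geodesic_dist_le_iff[OF x n(1) L0] le by blast
    from short_curve_move_end[OF short_curve_change_length[OF this n(1) L0 l] l n(1) z less_imp_le[OF n(2)]]
    have "short_curve \<epsilon> l (\<lambda>s. \<gamma> (min s (L n))) x z"
      by (rule short_curve_mono) (use n(3) in simp)
    then show ?thesis by blast
  qed
  then show ?thesis
    using short_curve_limit_exhausted[OF x z l] geodesic_dist_le_of_short_curve[OF _ x z l] by blast
qed

theorem compactin_geodesic_ball:
  assumes x: "x \<in> M" and L: "0 \<le> L"
  shows "compactin mtopology {y \<in> M. geodesic_dist M d x y \<le> ennreal L}" (is "compactin _ ?D")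
  unfolding compactin_sequentially
proof (intro conjI allI impI)
  obtain n where n: "\<And>\<epsilon> \<gamma> y. short_curve \<epsilon> L \<gamma> x y \<Longrightarrow> \<epsilon> \<le> c / 4 \<Longrightarrow> \<gamma> ` {0..L} \<subseteq> K n"
    using short_curve_bounded[OF x L] by blast
  have DK: "?D \<subseteq> K (Suc n)"
  proof clarify
    fix y assume y: "y \<in> M" "geodesic_dist M d x y \<le> ennreal L"
    then obtain \<gamma> where \<gamma>: "short_curve 0 L \<gamma> x y"
      using geodesic_dist_le_iff[OF x _ L] by blast
    then have "\<gamma> L \<in> K n"
      using n[OF \<gamma>] step_pos L by (auto simp: image_subset_iff)
    moreover have "d (\<gamma> L) y < c"
      using \<gamma> step_pos unfolding short_curve_def by linarith
    ultimately show "y \<in> K (Suc n)"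
      using step_K y(1) by blast
  qed
  fix \<sigma> :: "nat \<Rightarrow> 'a" assume \<sigma>: "range \<sigma> \<subseteq> ?D"
  then obtain l r where r: "strict_mono r" and lim: "limitin mtopology (\<sigma> \<circ> r) l sequentially"
    using compact_K[of "Suc n"] DK unfolding compactin_sequentially by (meson order_trans)
  have "geodesic_dist M d x l \<le> ennreal L"
    using \<sigma> L by (intro geodesic_dist_lower_semicontinuous[OF x lim tendsto_const]) auto
  moreover have "l \<in> M"
    using lim by (simp add: limitin_metric)
  ultimately show "\<exists>l r. l \<in> ?D \<and> strict_mono r \<and> limitin mtopology (\<sigma> \<circ> r) l sequentially"
    using r lim by blast
qed blast

text \<open>If the geodesic distance is infinite, the given curve has infinite length and is itself minimal.\<close>

theorem minimal_geodesic_exists: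
  assumes xy: "x \<in> M" "y \<in> M" and \<gamma>: "curve_in M d \<alpha> \<beta> \<gamma>" "connects \<alpha> \<beta> \<gamma> x y"
  shows "\<exists>\<alpha> \<beta> \<gamma>. minimal_geodesic M d x y \<alpha> \<beta> \<gamma>"
proof (cases "geodesic_dist M d x y")
  case (real L)
  then obtain \<gamma> where \<gamma>: "short_curve 0 L \<gamma> x y"
    using geodesic_dist_le_iff[OF xy, of L] by auto
  note \<gamma> = short_curve_0D[OF \<gamma> xy \<open>0 \<le> L\<close>]
  have "geodesic_dist M d x y \<le> curve_len d 0 L \<gamma>"
    unfolding geodesic_dist_def using \<gamma>(1,2) by (intro Inf_lower) blast
  then have "minimal_geodesic M d x y 0 L \<gamma>"
    using \<gamma> real unfolding minimal_geodesic_def by simp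
  then show ?thesis by blast
next
  case top
  have "geodesic_dist M d x y \<le> curve_len d \<alpha> \<beta> \<gamma>"
    unfolding geodesic_dist_def using \<gamma> by (intro Inf_lower) blast
  then have "minimal_geodesic M d x y \<alpha> \<beta> \<gamma>"
    using \<gamma> top unfolding minimal_geodesic_def by (simp add: top.extremum_unique)
  then show ?thesis by blast
qed

text \<open>A minimizing sequence lies in a geodesic ball around \<open>a 1\<close>, so a subsequence converges in \<open>d\<close>. Passing
  to a further subsequence along which all \<open>n\<close> bounded sequences of distances converge, lower
  semicontinuity of each distance shows that the limit point does not exceed the infimum. If the
  infimum is infinite, every point is a minimizer.\<close>

theorem sum_geodesic_dist_squared_attains_min:
  fixes a :: "nat \<Rightarrow> 'a"
  assumes ne: "M \<noteq> {}" and a: "\<And>j. j \<in> {1..n} \<Longrightarrow> a j \<in> M"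
  shows "\<exists>x\<in>M. \<forall>y\<in>M. (\<Sum>j = 1..n. (geodesic_dist M d x (a j))\<^sup>2) \<le> (\<Sum>j = 1..n. (geodesic_dist M d y (a j))\<^sup>2)"
proof (cases "n = 0 \<or> (INF x\<in>M. \<Sum>j = 1..n. (geodesic_dist M d x (a j))\<^sup>2) = top")
  case True
  obtain x where x: "x \<in> M" using ne by blast
  from True show ?thesis
  proof
    assume "n = 0"
    then show ?thesis using x by auto
  next
    assume inf: "(INF x\<in>M. \<Sum>j = 1..n. (geodesic_dist M d x (a j))\<^sup>2) = top"
    have eq: "(\<Sum>j = 1..n. (geodesic_dist M d y (a j))\<^sup>2) = top" if "y \<in> M" for y
      using INF_lower[OF that, of "\<lambda>x. \<Sum>j = 1..n. (geodesic_dist M d x (a j))\<^sup>2"]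
      unfolding inf by (rule top_le)
    show ?thesis
      using x by (intro bexI[of _ x] ballI) (simp_all only: eq order_refl)
  qed
next
  case False
  then have n: "0 < n" by simp
  let ?D = "geodesic_dist M d"
  define f where "f x = (\<Sum>j = 1..n. (?D x (a j))\<^sup>2)" for x
  obtain m where m: "(INF x\<in>M. f x) = ennreal m" "0 \<le> m"
    using False unfolding f_def by (cases "INF x\<in>M. f x") (auto simp: f_def)
  have "\<exists>x\<in>M. f x < ennreal (m + 1 / Suc k)" for k
  proof -
    have "(INF x\<in>M. f x) < ennreal (m + 1 / Suc k)"
      unfolding m(1) using m(2) by (intro ennreal_lessI) (auto intro: add_nonneg_pos)
    then show ?thesis by (simp add: INF_less_iff)
  qed
  then obtain x where x: "\<And>k. x k \<in> M" "\<And>k. f (x k) < ennreal (m + 1 / Suc k)"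
    by metis
  define l where "l k j = enn2real (?D (x k) (a j))" for k j
  have D: "?D (x k) (a j) = ennreal (l k j)" if j: "j \<in> {1..n}" for k j
  proof -
    have "(?D (x k) (a j))\<^sup>2 \<le> f (x k)"
      unfolding f_def using j by (intro member_le_sum) auto
    also have "\<dots> < top"
      using x(2)[of k] ennreal_less_top less_trans by blast
    finally have "?D (x k) (a j) < top"
      by (auto simp: less_top[symmetric] power_eq_top_ennreal)
    then show ?thesis by (simp add: l_def)
  qed
  have l0: "0 \<le> l k j" for k j by (simp add: l_def)
  have f: "f (x k) = ennreal (\<Sum>j = 1..n. (l k j)\<^sup>2)" for k
    unfolding f_def by (simp add: D ennreal_power l0 sum_ennreal)
  have sum_le: "(\<Sum>j = 1..n. (l k j)\<^sup>2) \<le> m + 1 / Suc k" for k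
    using less_imp_le[OF x(2)[of k]] m(2) unfolding f
    by (subst (asm) ennreal_le_iff) (auto intro: add_nonneg_nonneg)
  define \<rho> where "\<rho> = sqrt (m + 1)"
  have l_le: "l k j \<le> \<rho>" if j: "j \<in> {1..n}" for k j
  proof -
    have "(l k j)\<^sup>2 \<le> (\<Sum>j = 1..n. (l k j)\<^sup>2)"
      using j by (intro member_le_sum) auto
    also have "\<dots> \<le> m + 1"
      using sum_le[of k] by (rule order_trans) simp
    finally show ?thesis
      unfolding \<rho>_def by (rule real_le_rsqrt)
  qed
  have a1: "a 1 \<in> M" and \<rho>: "0 \<le> \<rho>"
    using a n m(2) by (auto simp: \<rho>_def)
  have "?D (a 1) (x k) \<le> ennreal \<rho>" for k
    using D[of 1 k] l_le[of 1 k] n geodesic_dist_commute[OF x(1) a1] by (simp add: ennreal_leI)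
  then have "range x \<subseteq> {y \<in> M. ?D (a 1) y \<le> ennreal \<rho>}"
    using x(1) by blast
  then obtain z r where r: "strict_mono r" and z: "limitin mtopology (x \<circ> r) z sequentially"
    using compactin_geodesic_ball[OF a1 \<rho>] unfolding compactin_sequentially by meson
  obtain q where q: "strict_mono q" and "\<And>j. j \<in> {1..n} \<Longrightarrow> \<exists>b. (\<lambda>k. l (r (q k)) j) \<longlonglongrightarrow> b"
    using function_convergent_subsequence[of "{1..n}" "\<lambda>k. l (r k)" \<rho>] l_le l0 by auto
  then obtain b where b: "\<And>j. j \<in> {1..n} \<Longrightarrow> (\<lambda>k. l (r (q k)) j) \<longlonglongrightarrow> b j"
    by metis
  have zq: "limitin mtopology (\<lambda>k. x (r (q k))) z sequentially"
    using limitin_subsequence[OF q z] by (simp add: o_def)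
  then have zM: "z \<in> M" by (simp add: limitin_metric)
  have "?D z (a j) \<le> ennreal (b j)" if j: "j \<in> {1..n}" for j
  proof -
    have "?D (a j) z \<le> ennreal (b j)"
      using D[OF j] geodesic_dist_commute[OF x(1) a[OF j]]
      by (intro geodesic_dist_lower_semicontinuous[OF a[OF j] zq b[OF j] l0]) simp
    then show ?thesis
      using geodesic_dist_commute[OF zM a[OF j]] by simp
  qed
  moreover have b0: "0 \<le> b j" if "j \<in> {1..n}" for j
    using LIMSEQ_le_const[OF b[OF that], of 0] l0 by blast
  ultimately have "f z \<le> (\<Sum>j = 1..n. (ennreal (b j))\<^sup>2)"
    unfolding f_def by (intro sum_mono power_mono) auto
  also have "\<dots> = ennreal (\<Sum>j = 1..n. (b j)\<^sup>2)"
    using b0 by (simp add: ennreal_power sum_ennreal)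
  also have "\<dots> \<le> ennreal m"
  proof (rule ennreal_leI, rule LIMSEQ_le)
    show "(\<lambda>k. \<Sum>j = 1..n. (l (r (q k)) j)\<^sup>2) \<longlonglongrightarrow> (\<Sum>j = 1..n. (b j)\<^sup>2)"
      by (intro tendsto_sum tendsto_power b)
    have "(\<lambda>k. m + 1 / real (Suc k)) \<longlonglongrightarrow> m + 0"
      by (intro tendsto_add tendsto_const LIMSEQ_inverse_real_of_nat[unfolded inverse_eq_divide])
    from LIMSEQ_subseq_LIMSEQ[OF this strict_mono_o[OF r q]]
    show "(\<lambda>k. m + 1 / real (Suc (r (q k)))) \<longlonglongrightarrow> m"
      by (simp add: o_def)
  qed (use sum_le in blast)
  finally have "f z \<le> f y" if "y \<in> M" for y
    using m(1) INF_lower[OF that, of f] by simp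
  then show ?thesis
    using zM unfolding f_def by blast
qed

end

section \<open>The triangle inequality in \<open>L\<^sup>p\<close>\<close>

lemma convex_powr_nonneg:
  fixes p t u v :: real
  assumes p: "1 \<le> p" and t: "0 \<le> t" "t \<le> 1" and uv: "0 \<le> u" "0 \<le> v"
  shows "(t * u + (1 - t) * v) powr p \<le> t * u powr p + (1 - t) * v powr p"
proof -
  have small: "(s * w) powr p \<le> s * w powr p" if "0 \<le> s" "s \<le> 1" "0 \<le> w" for s w :: real
  proof -
    have "s powr p \<le> s"
      using that p powr_mono'[of 1 p s] by (cases "s = 0") auto
    then show ?thesis
      using that by (simp add: powr_mult mult_right_mono)
  qed
  show ?thesis
  proof (cases "u = 0 \<or> v = 0")
    case True
    then show ?thesis
      using small[of t u] small[of "1 - t" v] t uv p by auto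
  next
    case False
    then show ?thesis
      using convex_onD[OF powr_convex[OF p], of "1 - t" u v] t uv by (simp add: algebra_simps)
  qed
qed

lemma Lp_norm_powr:
  assumes "0 < p"
  shows "Lp_norm p f powr p = (\<integral>x. \<bar>f x\<bar> powr p \<partial>lebesgue)"
proof -
  have "0 \<le> (\<integral>x. \<bar>f x\<bar> powr p \<partial>lebesgue)"
    by (rule integral_nonneg_AE) simp
  then show ?thesis
    using assms by (simp add: Lp_norm_def powr_powr)
qed

lemma Lp_norm_nonneg: "0 \<le> Lp_norm p f"
  by (simp add: Lp_norm_def)

lemma Lp_norm_le_iff:
  assumes "0 < p" "0 \<le> a"
  shows "Lp_norm p f \<le> a \<longleftrightarrow> (\<integral>x. \<bar>f x\<bar> powr p \<partial>lebesgue) \<le> a powr p"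
  using assms Lp_norm_powr[of p f] Lp_norm_nonneg[of p f]
  by (metis linorder_not_le powr_less_mono2 powr_mono2 less_imp_le)

text \<open>If \<open>a\<close> and \<open>b\<close> exceed the two norms, then \<open>(f + g) / (a + b)\<close> is a convex combination of \<open>f / a\<close> and
  \<open>g / b\<close>, whose \<open>p\<close>-th powers have integrals at most \<open>1\<close>. By convexity of the \<open>p\<close>-th power the norm
  of \<open>f + g\<close> is at most \<open>a + b\<close>.\<close>

lemma Lp_norm_triangle:
  fixes f g :: "'a::euclidean_space \<Rightarrow> real"
  assumes p: "1 \<le> p" and f: "in_Lp p f" and g: "in_Lp p g"
  shows "Lp_norm p (\<lambda>x. f x + g x) \<le> Lp_norm p f + Lp_norm p g"
proof (rule field_le_epsilon)
  fix e :: real assume e: "0 < e"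
  \<comment> \<open>The strict excess keeps the divisors \<open>a\<close> and \<open>b\<close> positive when a norm vanishes.\<close>
  define a b where "a = Lp_norm p f + e / 2" and "b = Lp_norm p g + e / 2"
  have ab: "0 < a" "0 < b" "Lp_norm p f \<le> a" "Lp_norm p g \<le> b"
    using e Lp_norm_nonneg[of p f] Lp_norm_nonneg[of p g] by (auto simp: a_def b_def)
  define t where "t = a / (a + b)"
  have t: "0 \<le> t" "t \<le> 1" "1 - t = b / (a + b)"
    using ab by (auto simp: t_def field_simps)
  define h where "h x = (a + b) powr p * (t * (\<bar>f x\<bar> powr p / a powr p) + (1 - t) * (\<bar>g x\<bar> powr p / b powr p))" for x
  have int: "integrable lebesgue (\<lambda>x. \<bar>f x\<bar> powr p)" "integrable lebesgue (\<lambda>x. \<bar>g x\<bar> powr p)"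
    using f g by (auto simp: in_Lp_def)
  then have h: "integrable lebesgue h"
    unfolding h_def by auto
  have le: "\<bar>f x + g x\<bar> powr p \<le> h x" for x
  proof -
    have "t * (\<bar>f x\<bar> / a) + (1 - t) * (\<bar>g x\<bar> / b) = (\<bar>f x\<bar> + \<bar>g x\<bar>) / (a + b)"
      unfolding t(3) using ab by (simp add: t_def add_divide_distrib)
    then have "\<bar>f x\<bar> + \<bar>g x\<bar> = (a + b) * (t * (\<bar>f x\<bar> / a) + (1 - t) * (\<bar>g x\<bar> / b))"
      using ab by simp
    then have "\<bar>f x + g x\<bar> \<le> (a + b) * (t * (\<bar>f x\<bar> / a) + (1 - t) * (\<bar>g x\<bar> / b))"
      using abs_triangle_ineq[of "f x" "g x"] by linarith
    then have "\<bar>f x + g x\<bar> powr p \<le> ((a + b) * (t * (\<bar>f x\<bar> / a) + (1 - t) * (\<bar>g x\<bar> / b))) powr p"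
      using p by (intro powr_mono2) auto
    also have "\<dots> = (a + b) powr p * (t * (\<bar>f x\<bar> / a) + (1 - t) * (\<bar>g x\<bar> / b)) powr p"
      using ab t by (intro powr_mult)
    also have "\<dots> \<le> h x"
      unfolding h_def using ab t p convex_powr_nonneg[OF p t(1,2), of "\<bar>f x\<bar> / a" "\<bar>g x\<bar> / b"]
      by (intro mult_left_mono) (auto simp: powr_divide)
    finally show ?thesis .
  qed
  have "(\<integral>x. \<bar>f x + g x\<bar> powr p \<partial>lebesgue) \<le> integral\<^sup>L lebesgue h"
    by (rule integral_mono'[OF h le]) (use le in \<open>auto intro: order_trans[OF powr_ge_zero]\<close>)
  also have "\<dots> = (a + b) powr p * (t * ((\<integral>x. \<bar>f x\<bar> powr p \<partial>lebesgue) / a powr p)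
      + (1 - t) * ((\<integral>x. \<bar>g x\<bar> powr p \<partial>lebesgue) / b powr p))"
    unfolding h_def using int by simp
  also have "\<dots> \<le> (a + b) powr p * (t * 1 + (1 - t) * 1)"
  proof (intro mult_left_mono add_mono)
    show "(\<integral>x. \<bar>f x\<bar> powr p \<partial>lebesgue) / a powr p \<le> 1" "(\<integral>x. \<bar>g x\<bar> powr p \<partial>lebesgue) / b powr p \<le> 1"
      using ab p Lp_norm_le_iff[of p a f] Lp_norm_le_iff[of p b g] by (simp_all add: divide_le_eq)
  qed (use t in auto)
  finally have "Lp_norm p (\<lambda>x. f x + g x) \<le> a + b"
    using Lp_norm_le_iff[of p "a + b" "\<lambda>x. f x + g x"] p ab by simp
  then show "Lp_norm p (\<lambda>x. f x + g x) \<le> Lp_norm p f + Lp_norm p g + e"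
    by (simp add: a_def b_def)
qed

section \<open>Compact sets and their distance functions\<close>

lemma infdist_le_of_subset_nhd:
  assumes "A \<noteq> {}" "\<And>a. a \<in> A \<Longrightarrow> infdist a B \<le> e"
  shows "infdist x B \<le> infdist x A + e"
proof -
  have "infdist x B - e \<le> dist x a" if "a \<in> A" for a
    using infdist_triangle[of x B a] assms(2)[OF that] by linarith
  then have "infdist x B - e \<le> infdist x A"
    using assms(1) by (simp add: infdist_notempty cINF_greatest)
  then show ?thesis by linarith
qed

lemma norm_diff_le_infdist:
  fixes A :: "'a::euclidean_space set"
  assumes "A \<noteq> {}" "A \<subseteq> cball 0 R"
  shows "norm x - R \<le> infdist x A"
proof -
  have "norm x - R \<le> dist x a" if "a \<in> A" for a
    using that assms(2) norm_triangle_ineq2[of x a] by (auto simp: dist_norm)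
  then show ?thesis
    using assms(1) by (simp add: infdist_notempty cINF_greatest)
qed

text \<open>By Arzela and Ascoli the distance functions, which are \<open>1\<close>-Lipschitz, converge uniformly on the ball
  along a subsequence. The zero set \<open>A\<close> of the limit \<open>g\<close> is the limit set: its points are
  approximated by points of \<open>B (r n)\<close>, and conversely \<open>B (r n)\<close> finally leaves every closed part of the
  ball on which \<open>g\<close> is positive, in particular the part at distance at least \<open>e\<close> from \<open>A\<close>.\<close>

lemma Blaschke_selection:
  fixes B :: "nat \<Rightarrow> 'a::euclidean_space set"
  assumes B: "\<And>n. B n \<noteq> {}" "\<And>n. B n \<subseteq> cball 0 R"
  obtains A r where "compact A" "A \<noteq> {}" "A \<subseteq> cball 0 R" "strict_mono (r :: nat \<Rightarrow> nat)"
    "\<And>x. (\<lambda>n. infdist x (B (r n))) \<longlonglongrightarrow> infdist x A"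
proof -
  let ?S = "cball (0::'a) R"
  have bound: "norm (infdist x (B n)) \<le> 2 * R" if "x \<in> ?S" for n x
  proof -
    obtain b where b: "b \<in> B n" using B(1) by blast
    then have "infdist x (B n) \<le> dist x b" "b \<in> ?S"
      using infdist_le B(2) by blast+
    then show ?thesis
      using norm_triangle_ineq4[of x b] that infdist_nonneg[of x "B n"] by (simp add: dist_norm)
  qed
  have equi: "\<exists>d>0. \<forall>n y. y \<in> ?S \<and> norm (x - y) < d \<longrightarrow> norm (infdist x (B n) - infdist y (B n)) < e"
    if "0 < e" for x :: 'a and e
    using that infdist_triangle_abs[of x _] by (intro exI[of _ e]) (auto simp: dist_norm intro: le_less_trans)
  obtain g r where g: "continuous_on ?S g" and r: "strict_mono (r :: nat \<Rightarrow> nat)"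
    and lim: "\<And>e. 0 < e \<Longrightarrow> \<exists>N. \<forall>n x. N \<le> n \<and> x \<in> ?S \<longrightarrow> norm (infdist x (B (r n)) - g x) < e"
    using Arzela_Ascoli[of ?S "\<lambda>n x. infdist x (B n)" "2 * R"] bound equi by (metis compact_cball)
  define A where "A = {x \<in> ?S. g x = 0}"
  have A: "compact A"
  proof -
    have "closed A"
      unfolding A_def by (rule continuous_closed_preimage_constant[OF g closed_cball])
    moreover have "bounded A"
      by (rule bounded_subset[OF bounded_cball[of 0 R]]) (auto simp: A_def)
    ultimately show ?thesis
      by (simp add: compact_eq_bounded_closed)
  qed
  have g_nonneg: "0 \<le> g x" if x: "x \<in> ?S" for x
  proof (rule field_le_epsilon)
    fix e :: real assume "0 < e"
    then obtain N where "norm (infdist x (B (r N)) - g x) < e"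
      using lim x by blast
    then show "0 \<le> g x + e"
      using infdist_nonneg[of x "B (r N)"] by (simp add: abs_less_iff)
  qed
  have avoid: "\<exists>N. \<forall>n\<ge>N. B (r n) \<inter> T = {}" if T: "closed T" "T \<subseteq> ?S" "T \<inter> A = {}" for T
  proof (cases "T = {}")
    case False
    have "compact T"
      using T by (meson bounded_subset bounded_cball compact_eq_bounded_closed)
    then obtain z where z: "z \<in> T" "\<And>x. x \<in> T \<Longrightarrow> g z \<le> g x"
      using continuous_attains_inf[OF _ False continuous_on_subset[OF g T(2)]] by blast
    then have "0 < g z"
      using T g_nonneg[of z] by (force simp: A_def)
    then obtain N where N: "\<And>n x. N \<le> n \<Longrightarrow> x \<in> ?S \<Longrightarrow> norm (infdist x (B (r n)) - g x) < g z"
      using lim by meson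
    have "x \<notin> B (r n)" if "N \<le> n" "x \<in> T" for n x
      using N[of n x] z(2)[of x] that T(2) infdist_zero[of x "B (r n)"] by (auto simp: abs_less_iff)
    then show ?thesis by blast
  qed simp
  have ne: "A \<noteq> {}"
  proof
    assume "A = {}"
    then obtain N where "B (r N) \<inter> ?S = {}"
      using avoid[of ?S] by auto
    then show False using B by blast
  qed
  have "(\<lambda>n. infdist x (B (r n))) \<longlonglongrightarrow> infdist x A" for x
  proof (rule metric_LIMSEQ_I)
    fix e :: real assume e: "0 < e"
    obtain N where N: "\<And>n x. N \<le> n \<Longrightarrow> x \<in> ?S \<Longrightarrow> norm (infdist x (B (r n)) - g x) < e / 2"
      using lim[of "e / 2"] e by auto
    have "closed {x. e / 2 \<le> infdist x A}"
      by (intro closed_Collect_le continuous_intros)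
    moreover have "?S \<inter> {x. e / 2 \<le> infdist x A} \<inter> A = {}"
      using e by auto
    ultimately obtain N' where N': "\<And>n. N' \<le> n \<Longrightarrow> B (r n) \<inter> (?S \<inter> {x. e / 2 \<le> infdist x A}) = {}"
      using avoid[of "?S \<inter> {x. e / 2 \<le> infdist x A}"] by (metis Int_lower1 closed_Int closed_cball)
    have "dist (infdist x (B (r n))) (infdist x A) < e" if n: "max N N' \<le> n" for n
    proof -
      have "infdist x (B (r n)) \<le> infdist x A + e / 2"
        using N[of n] n by (intro infdist_le_of_subset_nhd[OF ne]) (force simp: A_def abs_less_iff)
      moreover have "infdist x A \<le> infdist x (B (r n)) + e / 2"
        using N'[of n] n B(2) by (intro infdist_le_of_subset_nhd[OF B(1)]) force
      ultimately show ?thesis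
        using e by (simp add: dist_real_def abs_less_iff)
    qed
    then show "\<exists>N. \<forall>n\<ge>N. dist (infdist x (B (r n))) (infdist x A) < e" by blast
  qed
  then show thesis
    using that[of A r] A ne r unfolding A_def by blast
qed

section \<open>The metric given by an admissible function\<close>

text \<open>The parameter \<open>E\<close> carries the type of the ambient Euclidean space.\<close>

locale admissible_profile =
  fixes p :: real and \<phi> :: "real \<Rightarrow> real" and E :: "'a::euclidean_space itself"
  assumes p: "1 < p" and admissible: "admissible TYPE('a) p \<phi>"
begin

lemma \<phi>_pos: "0 \<le> r \<Longrightarrow> 0 < \<phi> r"
  using admissible by (simp add: admissible_def)

lemma \<phi>_less: "0 \<le> r \<Longrightarrow> r < s \<Longrightarrow> \<phi> s < \<phi> r"
  using admissible by (auto simp: admissible_def monotone_on_def)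

lemma \<phi>_le: "0 \<le> r \<Longrightarrow> r \<le> s \<Longrightarrow> \<phi> s \<le> \<phi> r"
  using \<phi>_less[of r s] by (cases "r = s") auto

lemma continuous_on_\<phi>: "continuous_on {0..} \<phi>"
  using admissible by (auto simp: admissible_def intro: differentiable_imp_continuous_on)

lemma continuous_on_profile:
  fixes f :: "'a \<Rightarrow> real"
  assumes "continuous_on UNIV f" "\<And>x. 0 \<le> f x"
  shows "continuous_on UNIV (\<lambda>x. \<phi> (f x))"
  using continuous_on_compose2[OF continuous_on_\<phi> assms(1)] assms(2) by auto

lemma measurable_profile [measurable]: "(\<lambda>x::'a. \<phi> (infdist x A)) \<in> borel_measurable borel"
  by (intro borel_measurable_continuous_onI continuous_on_profile continuous_intros infdist_nonneg)

lemma measurable_profile_lebesgue [measurable]: "(\<lambda>x::'a. \<phi> (infdist x A)) \<in> borel_measurable lebesgue"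
  by (intro measurable_completion) simp

text \<open>Outside the ball of radius \<open>2 R\<close> a point \<open>x\<close> has distance at least \<open>norm x / 2\<close> from every nonempty
  subset of the ball of radius \<open>R\<close>, inside it \<open>\<phi>\<close> is at most \<open>\<phi> 0\<close>. This gives one integrable
  function above the \<open>p\<close>-th powers of all \<open>\<phi> (infdist x A)\<close>.\<close>

definition majorant :: "real \<Rightarrow> 'a \<Rightarrow> real" where
  "majorant R x = \<phi> (norm x / 2) powr p + \<phi> 0 powr p * indicator (cball 0 (2 * R)) x"

lemma integrable_majorant: "integrable lebesgue (majorant R)"
proof -
  have meas: "(\<lambda>x::'a. \<phi> (norm x)) \<in> borel_measurable borel" "(\<lambda>x::'a. \<phi> (norm x / 2)) \<in> borel_measurable borel"
    by (intro borel_measurable_continuous_onI continuous_on_profile continuous_intros; simp)+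
  have "integrable lebesgue (\<lambda>x::'a. \<bar>\<phi> (norm x)\<bar> powr p)"
    using admissible by (simp add: admissible_def in_Lp_def)
  then have "integrable lborel (\<lambda>x::'a. \<phi> (norm x) powr p)"
    using meas(1) by (simp add: integrable_completion abs_of_pos \<phi>_pos)
  \<comment> \<open>Lebesgue measure is the rescaled image of itself under the dilation by \<open>1/2\<close>.\<close>
  moreover have scale: "lborel = density (distr lborel borel (\<lambda>x::'a. (1/2) *\<^sub>R x)) (\<lambda>_. ennreal ((1/2) ^ DIM('a)))"
    using lborel_affine[of "1/2" "0::'a"] by simp
  ultimately have "integrable (density (distr lborel borel (\<lambda>x::'a. (1/2) *\<^sub>R x)) (\<lambda>_. ennreal ((1/2) ^ DIM('a))))
    (\<lambda>x. \<phi> (norm x) powr p)"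
    by (simp only: scale[symmetric])
  then have "integrable lborel (\<lambda>x::'a. \<phi> (norm x / 2) powr p)"
    using meas by (subst (asm) integrable_density) (auto simp: integrable_distr_eq)
  then have "integrable lebesgue (\<lambda>x::'a. \<phi> (norm x / 2) powr p)"
    using meas by (subst integrable_completion) auto
  moreover have "integrable lebesgue (\<lambda>x::'a. \<phi> 0 powr p * indicator (cball 0 (2 * R)) x)"
    using emeasure_bounded_finite[OF bounded_cball[of "0::'a" "2 * R"]]
    by (intro integrable_mult_right integrable_real_indicator) auto
  ultimately show ?thesis
    unfolding majorant_def by (rule Bochner_Integration.integrable_add)
qed

lemma profile_powr_le_majorant:
  assumes "A \<noteq> {}" "A \<subseteq> cball 0 R"
  shows "\<phi> (infdist x A) powr p \<le> majorant R x"
proof (cases "norm x \<le> 2 * R")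
  case True
  have "\<phi> (infdist x A) powr p \<le> \<phi> 0 powr p"
    using p \<phi>_le[of 0 "infdist x A"] \<phi>_pos[of "infdist x A"] infdist_nonneg[of x A]
    by (intro powr_mono2) auto
  then show ?thesis
    using True by (simp add: majorant_def add_increasing)
next
  case False
  then have "norm x / 2 \<le> infdist x A"
    using norm_diff_le_infdist[OF assms, of x] by linarith
  then have "\<phi> (infdist x A) powr p \<le> \<phi> (norm x / 2) powr p"
    using p \<phi>_le[of "norm x / 2" "infdist x A"] \<phi>_pos[of "infdist x A"] infdist_nonneg[of x A]
    by (intro powr_mono2) auto
  then show ?thesis
    using False by (simp add: majorant_def)
qed

lemma profile_diff_powr_le_majorant:
  assumes "A \<noteq> {}" "A \<subseteq> cball 0 R" "B \<noteq> {}" "B \<subseteq> cball 0 R"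
  shows "\<bar>\<phi> (infdist x A) - \<phi> (infdist x B)\<bar> powr p \<le> majorant R x"
proof -
  have "\<bar>\<phi> (infdist x A) - \<phi> (infdist x B)\<bar> \<le> max (\<phi> (infdist x A)) (\<phi> (infdist x B))"
    using \<phi>_pos[OF infdist_nonneg, of x A] \<phi>_pos[OF infdist_nonneg, of x B] by linarith
  then have "\<bar>\<phi> (infdist x A) - \<phi> (infdist x B)\<bar> powr p \<le> max (\<phi> (infdist x A)) (\<phi> (infdist x B)) powr p"
    using p by (intro powr_mono2) auto
  also have "\<dots> \<le> majorant R x"
    using profile_powr_le_majorant[OF assms(1,2)] profile_powr_le_majorant[OF assms(3,4)]
    by (auto simp: max_def)
  finally show ?thesis .
qed

lemma compacts_bounded:
  fixes A B :: "'a set"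
  assumes "A \<in> compacts" "B \<in> compacts"
  obtains R where "A \<noteq> {}" "A \<subseteq> cball 0 R" "B \<noteq> {}" "B \<subseteq> cball 0 R"
proof -
  have "bounded (A \<union> B)"
    using assms by (auto simp: compacts_def compact_imp_bounded)
  then obtain R where "\<forall>x\<in>A \<union> B. norm x \<le> R"
    unfolding bounded_iff by blast
  then have "A \<union> B \<subseteq> cball 0 R"
    by auto
  then show thesis
    using that assms by (auto simp: compacts_def)
qed

lemma in_Lp_profile_diff:
  fixes A B :: "'a set"
  assumes "A \<in> compacts" "B \<in> compacts"
  shows "in_Lp p (\<lambda>x. \<phi> (infdist x A) - \<phi> (infdist x B))"
proof -
  obtain R where "A \<noteq> {}" "A \<subseteq> cball 0 R" "B \<noteq> {}" "B \<subseteq> cball 0 R"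
    using compacts_bounded[OF assms] .
  then have le: "\<bar>\<phi> (infdist x A) - \<phi> (infdist x B)\<bar> powr p \<le> majorant R x" for x
    by (rule profile_diff_powr_le_majorant)
  have "integrable lebesgue (\<lambda>x. \<bar>\<phi> (infdist x A) - \<phi> (infdist x B)\<bar> powr p)"
    by (rule Bochner_Integration.integrable_bound[OF integrable_majorant[of R]])
      (use le in \<open>auto intro: order_trans[OF _ abs_ge_self]\<close>)
  then show ?thesis
    by (simp add: in_Lp_def)
qed

text \<open>The \<open>L\<^sup>p\<close> norm of a function of constant value \<open>\<phi> \<epsilon> - \<phi> (2 * \<epsilon>)\<close> on a ball of radius \<open>\<epsilon>\<close>.\<close>

definition separation :: "real \<Rightarrow> real" where
  "separation \<epsilon> = ((\<phi> \<epsilon> - \<phi> (2 * \<epsilon>)) powr p * measure lebesgue (ball (0::'a) \<epsilon>)) powr (1 / p)"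

lemma separation_pos: "0 < \<epsilon> \<Longrightarrow> 0 < separation \<epsilon>"
  using \<phi>_less[of \<epsilon> "2 * \<epsilon>"] content_ball_pos[of \<epsilon> "0::'a"] by (simp add: separation_def)

text \<open>On the ball of radius \<open>\<epsilon>\<close> around \<open>y\<close> the distance to \<open>B\<close> is at most \<open>\<epsilon>\<close>, but the distance to \<open>A\<close> is at
  least \<open>2 * \<epsilon>\<close>. The bound depends on \<open>\<epsilon>\<close> alone, which makes a small \<open>d\<close>-step move a compact set
  a bounded way, wherever it lies in space.\<close>

lemma separation_le_dist:
  fixes A B :: "'a set"
  assumes AB: "A \<in> compacts" "B \<in> compacts" and \<epsilon>: "0 < \<epsilon>"
    and y: "y \<in> B" "3 * \<epsilon> \<le> infdist y A"
  shows "separation \<epsilon> \<le> dist_p\<phi> p \<phi> A B"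
proof -
  have int: "integrable lebesgue (\<lambda>x. \<bar>\<phi> (infdist x A) - \<phi> (infdist x B)\<bar> powr p)"
    using in_Lp_profile_diff[OF AB] by (simp add: in_Lp_def)
  have "(\<phi> \<epsilon> - \<phi> (2 * \<epsilon>)) powr p * indicator (ball y \<epsilon>) x \<le> \<bar>\<phi> (infdist x A) - \<phi> (infdist x B)\<bar> powr p" for x
  proof (cases "x \<in> ball y \<epsilon>")
    case True
    have "infdist x B \<le> \<epsilon>"
      using infdist_le[OF y(1), of x] True by (simp add: dist_commute)
    then have "\<phi> \<epsilon> \<le> \<phi> (infdist x B)"
      by (intro \<phi>_le infdist_nonneg)
    moreover have "2 * \<epsilon> \<le> infdist x A"
      using infdist_triangle[of y A x] True y(2) by (simp add: dist_commute)
    then have "\<phi> (infdist x A) \<le> \<phi> (2 * \<epsilon>)"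
      using \<epsilon> by (intro \<phi>_le) auto
    ultimately show ?thesis
      using True p \<phi>_less[of \<epsilon> "2 * \<epsilon>"] \<epsilon> by (auto intro!: powr_mono2)
  qed simp
  then have "(\<integral>x. (\<phi> \<epsilon> - \<phi> (2 * \<epsilon>)) powr p * indicator (ball y \<epsilon>) x \<partial>lebesgue)
      \<le> (\<integral>x. \<bar>\<phi> (infdist x A) - \<phi> (infdist x B)\<bar> powr p \<partial>lebesgue)"
    by (intro integral_mono'[OF int]) auto
  moreover have "measure lebesgue (ball y \<epsilon>) = measure lebesgue (ball (0::'a) \<epsilon>)"
    using \<epsilon> by (simp add: content_ball)
  ultimately have "(\<phi> \<epsilon> - \<phi> (2 * \<epsilon>)) powr p * measure lebesgue (ball (0::'a) \<epsilon>)
      \<le> (\<integral>x. \<bar>\<phi> (infdist x A) - \<phi> (infdist x B)\<bar> powr p \<partial>lebesgue)"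
    by simp
  then show ?thesis
    unfolding separation_def dist_p\<phi>_def Lp_norm_def using p by (intro powr_mono2) auto
qed

lemma dist_p\<phi>_commute: "dist_p\<phi> p \<phi> A B = dist_p\<phi> p \<phi> B (A :: 'a set)"
  by (simp add: dist_p\<phi>_def Lp_norm_def abs_minus_commute)

lemma subset_of_dist_eq_0:
  fixes A B :: "'a set"
  assumes AB: "A \<in> compacts" "B \<in> compacts" and 0: "dist_p\<phi> p \<phi> A B = 0"
  shows "B \<subseteq> A"
proof
  fix y assume y: "y \<in> B"
  have "infdist y A \<le> 0"
  proof (rule ccontr)
    assume "\<not> infdist y A \<le> 0"
    then show False
      using separation_le_dist[OF AB _ y, of "infdist y A / 3"] separation_pos[of "infdist y A / 3"] 0 by simp
  qed
  then show "y \<in> A"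
    using AB infdist_nonneg[of y A] in_closed_iff_infdist_zero[of A y]
    by (auto simp: compacts_def compact_imp_closed)
qed

sublocale Metric_space "compacts :: 'a set set" "dist_p\<phi> p \<phi>"
proof
  fix A B C :: "'a set"
  show "0 \<le> dist_p\<phi> p \<phi> A B"
    by (simp add: dist_p\<phi>_def Lp_norm_nonneg)
  show "dist_p\<phi> p \<phi> A B = dist_p\<phi> p \<phi> B A"
    by (rule dist_p\<phi>_commute)
  assume A: "A \<in> compacts" and B: "B \<in> compacts"
  have "dist_p\<phi> p \<phi> A A = 0"
    using p by (simp add: dist_p\<phi>_def Lp_norm_def)
  then show "dist_p\<phi> p \<phi> A B = 0 \<longleftrightarrow> A = B"
    using subset_of_dist_eq_0[OF A B] subset_of_dist_eq_0[OF B A] dist_p\<phi>_commute[of A B] by auto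
  assume C: "C \<in> compacts"
  show "dist_p\<phi> p \<phi> A C \<le> dist_p\<phi> p \<phi> A B + dist_p\<phi> p \<phi> B C"
    using Lp_norm_triangle[OF _ in_Lp_profile_diff[OF A B] in_Lp_profile_diff[OF B C]] p
    by (simp add: dist_p\<phi>_def)
qed

lemma dist_tendsto_0:
  fixes A :: "'a set"
  assumes A: "A \<noteq> {}" "A \<subseteq> cball 0 R" and B: "\<And>n::nat. B n \<noteq> {}" "\<And>n. B n \<subseteq> cball 0 R"
    and lim: "\<And>x. (\<lambda>n. infdist x (B n)) \<longlonglongrightarrow> infdist x A"
  shows "(\<lambda>n. dist_p\<phi> p \<phi> (B n) A) \<longlonglongrightarrow> 0"
proof -
  have "(\<lambda>n. \<phi> (infdist x (B n))) \<longlonglongrightarrow> \<phi> (infdist x A)" for x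
    using continuous_on_tendsto_compose[OF continuous_on_\<phi> lim] by (simp add: infdist_nonneg)
  then have "(\<lambda>n. \<bar>\<phi> (infdist x (B n)) - \<phi> (infdist x A)\<bar> powr p) \<longlonglongrightarrow> \<bar>\<phi> (infdist x A) - \<phi> (infdist x A)\<bar> powr p" for x
    using p by (intro tendsto_powr2 tendsto_intros) auto
  then have "(\<lambda>n. \<integral>x. \<bar>\<phi> (infdist x (B n)) - \<phi> (infdist x A)\<bar> powr p \<partial>lebesgue)
      \<longlonglongrightarrow> integral\<^sup>L lebesgue (\<lambda>x::'a. 0)"
    using profile_diff_powr_le_majorant[OF B A] p
    by (intro integral_dominated_convergence[OF _ _ integrable_majorant[of R]]) auto
  then have "(\<lambda>n. (\<integral>x. \<bar>\<phi> (infdist x (B n)) - \<phi> (infdist x A)\<bar> powr p \<partial>lebesgue) powr (1 / p)) \<longlonglongrightarrow> 0 powr (1 / p)"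
    using p by (intro tendsto_powr2 tendsto_const) (auto intro!: eventuallyI integral_nonneg_AE)
  then show ?thesis
    by (simp add: dist_p\<phi>_def Lp_norm_def)
qed

text \<open>The selected subsequence converges in \<open>d\<close> by dominated convergence.\<close>

lemma compactin_bounded_compacts: "compactin mtopology {B \<in> compacts. B \<subseteq> cball 0 R}"
  unfolding compactin_sequentially
proof (intro conjI allI impI)
  fix \<sigma> :: "nat \<Rightarrow> 'a set" assume "range \<sigma> \<subseteq> {B \<in> compacts. B \<subseteq> cball 0 R}"
  then have \<sigma>: "\<sigma> n \<in> compacts" "\<sigma> n \<noteq> {}" "\<sigma> n \<subseteq> cball 0 R" for n
    by (auto simp: compacts_def)
  obtain A r where A: "compact A" "A \<noteq> {}" "A \<subseteq> cball 0 R" and r: "strict_mono r"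
    and lim: "\<And>x. (\<lambda>n. infdist x (\<sigma> (r n))) \<longlonglongrightarrow> infdist x A"
    using Blaschke_selection[of \<sigma> R] \<sigma> by metis
  have "limitin mtopology (\<sigma> \<circ> r) A sequentially"
    unfolding limitin_metric_dist_null
    using dist_tendsto_0[OF A(2,3) \<sigma>(2,3) lim] \<sigma>(1) A by (simp add: o_def compacts_def)
  then show "\<exists>l r. l \<in> {B \<in> compacts. B \<subseteq> cball 0 R} \<and> strict_mono r \<and> limitin mtopology (\<sigma> \<circ> r) l sequentially"
    using A r by (auto simp: compacts_def)
qed blast

text \<open>A step shorter than \<open>separation 1\<close> reaches only points at distance less than \<open>3\<close> from the old set.\<close>

sublocale step_exhausted_metric "compacts :: 'a set set" "dist_p\<phi> p \<phi>"
  "\<lambda>n. {B \<in> compacts. B \<subseteq> cball 0 (3 * real n)}" "separation 1"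
proof
  show "0 < separation 1"
    by (rule separation_pos) simp
  show "compactin mtopology {B \<in> compacts. B \<subseteq> cball 0 (3 * real n)}" for n
    by (rule compactin_bounded_compacts)
  show "(compacts :: 'a set set) \<subseteq> (\<Union>n. {B \<in> compacts. B \<subseteq> cball 0 (3 * real n)})"
  proof
    fix A :: "'a set" assume A: "A \<in> compacts"
    then obtain R where R: "A \<subseteq> cball 0 R"
      using compacts_bounded by metis
    obtain n :: nat where "R \<le> n"
      using real_arch_simple by blast
    then have "A \<subseteq> cball 0 (3 * real n)"
      using R by (force simp: subset_iff)
    then show "A \<in> (\<Union>n. {B \<in> compacts. B \<subseteq> cball 0 (3 * real n)})"
      using A by blast
  qed
  fix n and A B :: "'a set"
  assume "A \<in> {B \<in> compacts. B \<subseteq> cball 0 (3 * real n)}" and B: "B \<in> compacts"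
    and lt: "dist_p\<phi> p \<phi> A B < separation 1"
  then have A: "A \<in> compacts" "A \<noteq> {}" "A \<subseteq> cball 0 (3 * real n)"
    by (auto simp: compacts_def)
  have "norm y \<le> 3 * real (Suc n)" if "y \<in> B" for y
    using separation_le_dist[OF A(1) B _ that, of 1] lt norm_diff_le_infdist[OF A(2,3), of y] by force
  then show "B \<in> {B \<in> compacts. B \<subseteq> cball 0 (3 * real (Suc n))}"
    using B by auto
qed

text \<open>The segments from points of \<open>A\<close> to points of \<open>B\<close>, all traversed simultaneously.\<close>

definition interpolate :: "'a set \<Rightarrow> 'a set \<Rightarrow> real \<Rightarrow> 'a set" where
  "interpolate A B t = (\<lambda>(a, b). (1 - t) *\<^sub>R a + t *\<^sub>R b) ` (A \<times> B)"

text \<open>The distance functions of the interpolated sets depend on \<open>t\<close> in a Lipschitz way, uniformly in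
  space, and all these sets lie in one ball, so dominated convergence applies.\<close>

lemma curve_in_interpolate:
  fixes A B :: "'a set"
  assumes AB: "A \<in> compacts" "B \<in> compacts"
  shows "curve_in compacts (dist_p\<phi> p \<phi>) 0 1 (interpolate A B)"
proof -
  obtain R where R: "A \<noteq> {}" "A \<subseteq> cball 0 R" "B \<noteq> {}" "B \<subseteq> cball 0 R"
    using compacts_bounded[OF AB] .
  have compact: "compact (interpolate A B t)" for t
    unfolding interpolate_def using AB
    by (intro compact_continuous_image compact_Times)
      (auto simp: compacts_def case_prod_unfold intro!: continuous_intros)
  have ne: "interpolate A B t \<noteq> {}" for t
    using R by (simp add: interpolate_def)
  have ball: "interpolate A B t \<subseteq> cball 0 R" if "t \<in> {0..1}" for t
    using that R convexD_alt[OF convex_cball, of _ 0 R _ t] by (force simp: interpolate_def)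
  have dist_le: "dist ((1 - t) *\<^sub>R a + t *\<^sub>R b) ((1 - s) *\<^sub>R a + s *\<^sub>R b) \<le> \<bar>t - s\<bar> * (2 * R)"
    if "a \<in> A" "b \<in> B" for a b s t
  proof -
    have "(1 - t) *\<^sub>R a + t *\<^sub>R b - ((1 - s) *\<^sub>R a + s *\<^sub>R b) = (t - s) *\<^sub>R (b - a)"
      by (simp add: algebra_simps)
    moreover have "norm (b - a) \<le> 2 * R"
      using R that norm_triangle_ineq4[of b a] by fastforce
    ultimately show ?thesis
      by (simp add: dist_norm mult_left_mono)
  qed
  have near: "infdist x (interpolate A B s) \<le> infdist x (interpolate A B t) + \<bar>t - s\<bar> * (2 * R)" for x s t
  proof (rule infdist_le_of_subset_nhd[OF ne])
    fix z assume "z \<in> interpolate A B t"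
    then obtain a b where ab: "a \<in> A" "b \<in> B" and z: "z = (1 - t) *\<^sub>R a + t *\<^sub>R b"
      by (auto simp: interpolate_def)
    have "(1 - s) *\<^sub>R a + s *\<^sub>R b \<in> interpolate A B s"
      using ab by (auto simp: interpolate_def)
    then show "infdist z (interpolate A B s) \<le> \<bar>t - s\<bar> * (2 * R)"
      unfolding z by (rule infdist_le2) (rule dist_le[OF ab])
  qed
  show ?thesis
  proof (rule curve_inI)
    show "interpolate A B ` {0..1} \<subseteq> compacts"
      using compact ne by (auto simp: compacts_def)
    fix t :: real assume t: "t \<in> {0..1}"
    show "((\<lambda>s. dist_p\<phi> p \<phi> (interpolate A B t) (interpolate A B s)) \<longlongrightarrow> 0) (at t within {0..1})"
      unfolding tendsto_at_iff_sequentially o_def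
    proof (intro allI impI)
      fix s :: "nat \<Rightarrow> real" assume s: "\<forall>i. s i \<in> {0..1} - {t}" "s \<longlonglongrightarrow> t"
      have "(\<lambda>i. infdist x (interpolate A B (s i))) \<longlonglongrightarrow> infdist x (interpolate A B t)" for x
      proof (rule LIM_zero_cancel, rule Lim_null_comparison)
        show "\<forall>\<^sub>F i in sequentially. norm (infdist x (interpolate A B (s i)) - infdist x (interpolate A B t))
            \<le> \<bar>t - s i\<bar> * (2 * R)"
        proof (rule eventuallyI)
          fix i
          show "norm (infdist x (interpolate A B (s i)) - infdist x (interpolate A B t)) \<le> \<bar>t - s i\<bar> * (2 * R)"
            using near[of x "s i" t] near[of x t "s i"] unfolding real_norm_def abs_le_iff abs_minus_commute[of "s i" t] by linarith
        qed
        have "(\<lambda>i. \<bar>t - s i\<bar> * (2 * R)) \<longlonglongrightarrow> \<bar>t - t\<bar> * (2 * R)"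
          using s(2) by (intro tendsto_intros)
        then show "(\<lambda>i. \<bar>t - s i\<bar> * (2 * R)) \<longlonglongrightarrow> 0" by simp
      qed
      from dist_tendsto_0[OF ne ball[OF t] ne ball this]
      show "(\<lambda>i. dist_p\<phi> p \<phi> (interpolate A B t) (interpolate A B (s i))) \<longlonglongrightarrow> 0"
        using s(1) by (simp add: dist_p\<phi>_commute)
    qed
  qed simp
qed

lemma connects_interpolate:
  assumes "A \<in> compacts" "B \<in> compacts"
  shows "connects 0 1 (interpolate A B) A B"
  using assms by (force simp: connects_def interpolate_def compacts_def)

end

theorem theorem3p18:
  fixes p :: real and \<phi> :: "real \<Rightarrow> real"
  assumes "1 < p"
    and "admissible TYPE(real ^ 'n) p \<phi>"
    and "in_Lp p (\<lambda>x :: real ^ 'n. half_line_deriv \<phi> (norm x))"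
  shows
    "(\<forall>A \<in> (compacts :: (real ^ 'n) set set). \<forall>\<rho> > 0::real.
        compactin (Metric_space.mtopology compacts (dist_p\<phi> p \<phi>))
          {B \<in> compacts. geod_p\<phi> p \<phi> A B \<le> ennreal \<rho>})
     \<and> (\<forall>A \<in> (compacts :: (real ^ 'n) set set). \<forall>B \<in> compacts. \<exists>\<alpha> \<beta> \<gamma>.
        minimal_geodesic compacts (dist_p\<phi> p \<phi>) A B \<alpha> \<beta> \<gamma>)
     \<and> (\<forall>n (A :: nat \<Rightarrow> (real ^ 'n) set). (\<forall>j \<in> {1..n}. A j \<in> compacts) \<longrightarrow>
        (\<exists>B \<in> compacts. \<forall>C \<in> compacts.
           (\<Sum>j = 1..n. (geod_p\<phi> p \<phi> B (A j))\<^sup>2) \<le> (\<Sum>j = 1..n. (geod_p\<phi> p \<phi> C (A j))\<^sup>2)))"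
proof -
  interpret admissible_profile p \<phi> "TYPE(real ^ 'n)"
    using assms(1,2) by unfold_locales
  have ne: "(compacts :: (real ^ 'n) set set) \<noteq> {}"
    unfolding compacts_def using compact_sing by blast
  show ?thesis
    unfolding geod_p\<phi>_def
  proof (intro conjI ballI allI impI)
    fix A :: "(real ^ 'n) set" and \<rho> :: real
    assume "A \<in> compacts" "0 < \<rho>"
    then show "compactin mtopology {B \<in> compacts. geodesic_dist compacts (dist_p\<phi> p \<phi>) A B \<le> ennreal \<rho>}"
      by (intro compactin_geodesic_ball) auto
  next
    fix A B :: "(real ^ 'n) set"
    assume AB: "A \<in> compacts" "B \<in> compacts"
    show "\<exists>\<alpha> \<beta> \<gamma>. minimal_geodesic compacts (dist_p\<phi> p \<phi>) A B \<alpha> \<beta> \<gamma>"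
      by (rule minimal_geodesic_exists[OF AB curve_in_interpolate[OF AB] connects_interpolate[OF AB]])
  next
    fix n and A :: "nat \<Rightarrow> (real ^ 'n) set"
    assume "\<forall>j\<in>{1..n}. A j \<in> compacts"
    then show "\<exists>B\<in>compacts. \<forall>C\<in>compacts.
        (\<Sum>j = 1..n. (geodesic_dist compacts (dist_p\<phi> p \<phi>) B (A j))\<^sup>2)
          \<le> (\<Sum>j = 1..n. (geodesic_dist compacts (dist_p\<phi> p \<phi>) C (A j))\<^sup>2)"
      by (intro sum_geodesic_dist_squared_attains_min[OF ne]) auto
  qed
qed

end
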